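(* Let $(T,\mathcal{T},\mu)$ be a measure space with $\mu$ a $\sigma$-finite signed measure, and let $X_\alpha:\Omega_\alpha\to\mathbb{L}_\mu$ be an arbitrary net of maps. Then $X_\alpha$ converges weakly to a tight limit if and only if $X_\alpha$ is asymptotically tight and the marginals $(X_\alpha(t_1),\dots,X_\alpha(t_k))$ converge weakly (in $\mathbb{R}^k$) for every finite subset $t_1,\dots,t_k$ of $T$. Moreover, if $X_\alpha$ is asymptotically tight and its marginals converge weakly to the marginals $(X(t_1),\dots,X(t_k))$ of a stochastic process $X=\{X(t):t\in T\}$, then there is a version of $X$ with sample paths in $\mathbb{L}_\mu$, and $X_\alpha$ converges weakly to $X$ in $\mathbb{L}_\mu$.
   Context: $\mathbb{L}_\mu$ is the space of bounded and $\mu$-integrable functions $z:T\to\mathbb{R}$ with norm $\|z\|_{\mathbb{L}_\mu}=\bigl(\sup_{t\in T}|z(t)|\bigr)\vee\bigl(\int_T|z|\,|d\mu|\bigr)$, where $|d\mu|$ denotes integration with respect to the total variation measure. The net is indexed by an arbitrary directed set; each $X_\alpha$ is defined on its own probability space $(\Omega_\alpha,\mathcal{A}_\alpha,P_\alpha)$ and need not be measurable; $X_\alpha(t)$ is the map $\omega\mapsto X_\alpha(\omega)(t)$. Weak convergence is in the Hoffmann-Jørgensen sense: $\mathbb{E}^*h(X_\alpha)\to\mathbb{E}h(X)$ for every bounded continuous $h:\mathbb{L}_\mu\to\mathbb{R}$, with $X$ Borel measurable ($\mathbb{E}^*$ is outer expectation). A Borel measurable $X$ is tight if for every $\varepsilon>0$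 there is a compact $K$ with $\Pr(X\in K)\ge1-\varepsilon$. The net is asymptotically tight if for every $\varepsilon>0$ there is a compact $K\subset\mathbb{L}_\mu$ such that $\liminf_\alpha P_*(X_\alpha\in K^\delta)\ge1-\varepsilon$ for every $\delta>0$, where $K^\delta=\{z:d(z,K)<\delta\}$ and $P_*$ is inner probability. *)

theory Defs
  imports "HOL-Probability.Probability"
begin
text \<open>In \<^typ>\<open>ereal\<close> the sum of \<open>\<infinity>\<close> and \<open>-\<infinity>\<close> is \<open>\<infinity>\<close>; the second conjunct keeps this from ever occurring.\<close>

definition signed_measure :: "'t set \<Rightarrow> 't set set \<Rightarrow> ('t set \<Rightarrow> ereal) \<Rightarrow> bool" where
  "signed_measure T \<T> \<mu> \<longleftrightarrow>
     sigma_algebra T \<T> \<and>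
     ((\<forall>A\<in>\<T>. \<mu> A \<noteq> \<infinity>) \<or> (\<forall>A\<in>\<T>. \<mu> A \<noteq> -\<infinity>)) \<and>
     \<mu> {} = 0 \<and>
     (\<forall>A :: nat \<Rightarrow> 't set. range A \<subseteq> \<T> \<longrightarrow> disjoint_family A \<longrightarrow> (\<lambda>n. \<mu> (A n)) sums \<mu> (\<Union>n. A n))"

definition variation :: "'t set set \<Rightarrow> ('t set \<Rightarrow> ereal) \<Rightarrow> 't set \<Rightarrow> ennreal" where
  "variation \<T> \<mu> A =
     (SUP P \<in> {P. finite P \<and> P \<subseteq> \<T> \<and> partition_on A P}. \<Sum>B\<in>P. e2ennreal \<bar>\<mu> B\<bar>)"

text \<open>That this is a measure with \<^term>\<open>variation \<T> \<mu>\<close> as its values is \<open>emeasure_total_variation\<close> below.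
  A signed measure is \<open>\<sigma>\<close>-finite if its total variation is.\<close>

definition total_variation :: "'t set \<Rightarrow> 't set set \<Rightarrow> ('t set \<Rightarrow> ereal) \<Rightarrow> 't measure" where
  "total_variation T \<T> \<mu> = measure_of T \<T> (variation \<T> \<mu>)"

lemma variation_upper:
  assumes "finite P" "P \<subseteq> \<T>" "partition_on A P"
  shows "(\<Sum>B\<in>P. e2ennreal \<bar>\<mu> B\<bar>) \<le> variation \<T> \<mu> A"
  unfolding variation_def using assms by (intro SUP_upper) auto

lemma variation_Un:
  assumes T: "sigma_algebra T \<T>" and "A \<in> \<T>" "B \<in> \<T>" and disj: "A \<inter> B = {}"
  shows "variation \<T> \<mu> A + variation \<T> \<mu> B \<le> variation \<T> \<mu> (A \<union> B)"
proof -
  have ne: "{P. finite P \<and> P \<subseteq> \<T> \<and> partition_on C P} \<noteq> {}" if "C \<in> \<T>" for C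
  proof (cases "C = {}")
    case True
    then show ?thesis by (auto intro!: exI[of _ "{}"] simp: partition_on_def)
  next
    case False
    with that show ?thesis by (auto intro!: exI[of _ "{C}"] simp: partition_on_def disjoint_def)
  qed
  have 1: "(\<Sum>C\<in>P. e2ennreal \<bar>\<mu> C\<bar>) + (\<Sum>C\<in>Q. e2ennreal \<bar>\<mu> C\<bar>) \<le> variation \<T> \<mu> (A \<union> B)"
    if P: "finite P" "P \<subseteq> \<T>" "partition_on A P" and Q: "finite Q" "Q \<subseteq> \<T>" "partition_on B Q" for P Q
  proof -
    have PQ: "\<Union>P = A" "{} \<notin> P" "\<Union>Q = B" "disjoint P" "disjoint Q" "{} \<notin> Q"
      using P Q unfolding partition_on_def by blast+
    have "C = {}" if "C \<in> P" "C \<in> Q" for C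
      using Union_upper[OF that(1)] Union_upper[OF that(2)] PQ(1,3) disj by blast
    with PQ(2) have "P \<inter> Q = {}" by blast
    then have "(\<Sum>C\<in>P. e2ennreal \<bar>\<mu> C\<bar>) + (\<Sum>C\<in>Q. e2ennreal \<bar>\<mu> C\<bar>) = (\<Sum>C\<in>P\<union>Q. e2ennreal \<bar>\<mu> C\<bar>)"
      using P Q by (simp add: sum.union_disjoint)
    also have "\<dots> \<le> variation \<T> \<mu> (A \<union> B)"
    proof (rule variation_upper)
      have "disjoint (P \<union> Q)"
        using PQ disj by (intro disjoint_union) simp_all
      with PQ show "partition_on (A \<union> B) (P \<union> Q)"
        unfolding partition_on_def by simp
    qed (use P Q in auto)
    finally show ?thesis .
  qed
  have "variation \<T> \<mu> A + variation \<T> \<mu> B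
      = (SUP P \<in> {P. finite P \<and> P \<subseteq> \<T> \<and> partition_on A P}. (\<Sum>C\<in>P. e2ennreal \<bar>\<mu> C\<bar>) + variation \<T> \<mu> B)"
    unfolding variation_def[of \<T> \<mu> A] by (rule ennreal_SUP_add_left[symmetric, OF ne[OF \<open>A \<in> \<T>\<close>]])
  also have "\<dots> \<le> variation \<T> \<mu> (A \<union> B)"
  proof (rule SUP_least, clarify)
    fix P assume P: "finite P" "P \<subseteq> \<T>" "partition_on A P"
    have "(\<Sum>C\<in>P. e2ennreal \<bar>\<mu> C\<bar>) + variation \<T> \<mu> B
      = (SUP Q \<in> {P. finite P \<and> P \<subseteq> \<T> \<and> partition_on B P}. (\<Sum>C\<in>P. e2ennreal \<bar>\<mu> C\<bar>) + (\<Sum>C\<in>Q. e2ennreal \<bar>\<mu> C\<bar>))"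
      unfolding variation_def[of \<T> \<mu> B]
      using ne[OF \<open>B \<in> \<T>\<close>] by (rule ennreal_SUP_add_right)
    also have "\<dots> \<le> variation \<T> \<mu> (A \<union> B)"
      using 1[OF P] by (intro SUP_least) auto
    finally show "(\<Sum>C\<in>P. e2ennreal \<bar>\<mu> C\<bar>) + variation \<T> \<mu> B \<le> variation \<T> \<mu> (A \<union> B)" .
  qed
  finally show ?thesis .
qed

lemma e2ennreal_abs_sums_le:
  fixes x :: "nat \<Rightarrow> ereal"
  assumes "x sums s"
  shows "e2ennreal \<bar>s\<bar> \<le> (\<Sum>n. e2ennreal \<bar>x n\<bar>)"
proof -
  have lim: "(\<lambda>n. e2ennreal \<bar>\<Sum>i<n. x i\<bar>) \<longlonglongrightarrow> e2ennreal \<bar>s\<bar>"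
  proof -
    have "(\<lambda>n. \<bar>\<Sum>i<n. x i\<bar>) \<longlonglongrightarrow> \<bar>s\<bar>"
      using assms unfolding sums_def by (rule tendsto_abs_ereal)
    then show ?thesis by (rule tendsto_e2ennrealI)
  qed
  have abs_add: "\<bar>a + b\<bar> \<le> \<bar>a\<bar> + \<bar>b\<bar>" for a b :: ereal
    by (cases a; cases b) auto
  have abs_sum: "e2ennreal \<bar>\<Sum>i<n. x i\<bar> \<le> (\<Sum>i<n. e2ennreal \<bar>x i\<bar>)" for n
  proof (induction n)
    case (Suc n)
    have "e2ennreal \<bar>\<Sum>i<Suc n. x i\<bar> \<le> e2ennreal (\<bar>\<Sum>i<n. x i\<bar> + \<bar>x n\<bar>)"
      by (intro e2ennreal_mono) (simp add: abs_add)
    also have "\<dots> = e2ennreal \<bar>\<Sum>i<n. x i\<bar> + e2ennreal \<bar>x n\<bar>"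
      by (metis abs_ereal_pos e2ennreal_enn2ereal enn2ereal_e2ennreal plus_ennreal.rep_eq)
    also have "\<dots> \<le> (\<Sum>i<n. e2ennreal \<bar>x i\<bar>) + e2ennreal \<bar>x n\<bar>"
      using Suc by (rule add_right_mono)
    finally show ?case by simp
  qed simp
  show ?thesis
  proof (rule LIMSEQ_le_const2[OF lim], intro exI allI impI)
    fix n :: nat
    have "(\<Sum>i<n. e2ennreal \<bar>x i\<bar>) \<le> (\<Sum>n. e2ennreal \<bar>x n\<bar>)"
      by (rule sum_le_suminf) auto
    with abs_sum[of n] show "e2ennreal \<bar>\<Sum>i<n. x i\<bar> \<le> (\<Sum>n. e2ennreal \<bar>x n\<bar>)"
      by (rule order_trans)
  qed
qed

lemma variation_countably_additive:
  assumes \<mu>: "signed_measure T \<T> \<mu>"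
  shows "countably_additive \<T> (variation \<T> \<mu>)"
proof (rule countably_additiveI)
  fix A :: "nat \<Rightarrow> _ set"
  assume A: "range A \<subseteq> \<T>" "disjoint_family A" "(\<Union>i. A i) \<in> \<T>"
  interpret sigma_algebra T \<T> using \<mu> unfolding signed_measure_def by blast
  have sums: "(\<lambda>n. \<mu> (B n)) sums \<mu> (\<Union>n. B n)" if "range B \<subseteq> \<T>" "disjoint_family B" for B
    using \<mu> that unfolding signed_measure_def by blast
  have emp: "\<mu> {} = 0" using \<mu> unfolding signed_measure_def by blast
  show "(\<Sum>i. variation \<T> \<mu> (A i)) = variation \<T> \<mu> (\<Union>i. A i)"
  proof (rule antisym)
    have mono: "variation \<T> \<mu> C \<le> variation \<T> \<mu> D" if "C \<in> \<T>" "D \<in> \<T>" "C \<subseteq> D" for C D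
    proof -
      have "variation \<T> \<mu> C \<le> variation \<T> \<mu> C + variation \<T> \<mu> (D - C)" by simp
      also have "\<dots> \<le> variation \<T> \<mu> (C \<union> (D - C))"
        using that by (intro variation_Un[OF sigma_algebra_axioms]) auto
      also have "C \<union> (D - C) = D" using that by auto
      finally show ?thesis .
    qed
    have fin: "(\<Sum>i<n. variation \<T> \<mu> (A i)) \<le> variation \<T> \<mu> (\<Union>i<n. A i)" for n
    proof (induction n)
      case (Suc n)
      have "(\<Sum>i<Suc n. variation \<T> \<mu> (A i)) \<le> variation \<T> \<mu> (\<Union>i<n. A i) + variation \<T> \<mu> (A n)"
        using Suc by (simp add: add_right_mono)
      also have "\<dots> \<le> variation \<T> \<mu> ((\<Union>i<n. A i) \<union> A n)"
      proof (rule variation_Un[OF sigma_algebra_axioms])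
        show "(\<Union>i<n. A i) \<inter> A n = {}"
        proof -
          have "A i \<inter> A n = {}" if "i < n" for i
            using disjoint_family_onD[OF A(2), of i n] that by simp
          then show ?thesis by blast
        qed
      qed (use A in auto)
      also have "(\<Union>i<n. A i) \<union> A n = (\<Union>i<Suc n. A i)" by (auto simp: lessThan_Suc)
      finally show ?case .
    qed simp
    show "(\<Sum>i. variation \<T> \<mu> (A i)) \<le> variation \<T> \<mu> (\<Union>i. A i)"
    proof (rule suminf_le_const)
      fix n
      have "variation \<T> \<mu> (\<Union>i<n. A i) \<le> variation \<T> \<mu> (\<Union>i. A i)"
        using A by (intro mono) auto
      with fin[of n] show "(\<Sum>i<n. variation \<T> \<mu> (A i)) \<le> variation \<T> \<mu> (\<Union>i. A i)"
        by (rule order_trans)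
    qed auto
  next
    show "variation \<T> \<mu> (\<Union>i. A i) \<le> (\<Sum>i. variation \<T> \<mu> (A i))"
      unfolding variation_def[of \<T> \<mu> "\<Union>i. A i"]
    proof (rule SUP_least, clarify)
      fix P assume P: "finite P" "P \<subseteq> \<T>" "partition_on (\<Union>i. A i) P"
      have "(\<Sum>B\<in>P. e2ennreal \<bar>\<mu> B\<bar>) \<le> (\<Sum>B\<in>P. \<Sum>n. e2ennreal \<bar>\<mu> (B \<inter> A n)\<bar>)"
      proof (rule sum_mono)
        fix B assume "B \<in> P"
        then have B: "B \<in> \<T>" "B = (\<Union>n. B \<inter> A n)"
          using P unfolding partition_on_def by auto
        have "(\<lambda>n. \<mu> (B \<inter> A n)) sums \<mu> (\<Union>n. B \<inter> A n)"
          using A B(1) by (intro sums) (auto simp: disjoint_family_on_def)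
        then show "e2ennreal \<bar>\<mu> B\<bar> \<le> (\<Sum>n. e2ennreal \<bar>\<mu> (B \<inter> A n)\<bar>)"
          using e2ennreal_abs_sums_le B(2) by metis
      qed
      also have "\<dots> = (\<Sum>n. \<Sum>B\<in>P. e2ennreal \<bar>\<mu> (B \<inter> A n)\<bar>)"
        by (rule suminf_sum[symmetric]) auto
      also have "\<dots> \<le> (\<Sum>n. variation \<T> \<mu> (A n))"
      proof (rule suminf_le)
        fix n
        let ?P = "{B \<in> P. B \<inter> A n \<noteq> {}}"
        have inj: "inj_on (\<lambda>B. B \<inter> A n) ?P"
        proof (rule inj_onI)
          fix B C assume "B \<in> ?P" "C \<in> ?P" and eq: "B \<inter> A n = C \<inter> A n"
          then have "B \<in> P" "C \<in> P" "B \<inter> C \<noteq> {}" by auto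
          with P(3) show "B = C" unfolding partition_on_def disjoint_def by blast
        qed
        have "(\<Sum>B\<in>P. e2ennreal \<bar>\<mu> (B \<inter> A n)\<bar>) = (\<Sum>B\<in>?P. e2ennreal \<bar>\<mu> (B \<inter> A n)\<bar>)"
          using P(1) by (intro sum.mono_neutral_right) (auto simp: emp)
        also have "\<dots> = (\<Sum>C\<in>(\<lambda>B. B \<inter> A n) ` ?P. e2ennreal \<bar>\<mu> C\<bar>)"
          by (simp add: sum.reindex[OF inj])
        also have "\<dots> \<le> variation \<T> \<mu> (A n)"
        proof (rule variation_upper)
          show "(\<lambda>B. B \<inter> A n) ` ?P \<subseteq> \<T>" using A P by auto
          have "\<Union>((\<lambda>B. B \<inter> A n) ` ?P) = A n"
            using P(3) unfolding partition_on_def by blast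
          moreover have "disjoint ((\<lambda>B. B \<inter> A n) ` ?P)"
            using P(3) unfolding partition_on_def disjoint_def by blast
          ultimately show "partition_on (A n) ((\<lambda>B. B \<inter> A n) ` ?P)"
            unfolding partition_on_def by auto
        qed (use P in auto)
        finally show "(\<Sum>B\<in>P. e2ennreal \<bar>\<mu> (B \<inter> A n)\<bar>) \<le> variation \<T> \<mu> (A n)" .
      qed auto
      finally show "(\<Sum>B\<in>P. e2ennreal \<bar>\<mu> B\<bar>) \<le> (\<Sum>n. variation \<T> \<mu> (A n))" .
    qed
  qed
qed

lemma space_total_variation:
  assumes "signed_measure T \<T> \<mu>"
  shows "space (total_variation T \<T> \<mu>) = T"
proof -
  interpret sigma_algebra T \<T> using assms unfolding signed_measure_def by blast
  show ?thesis unfolding total_variation_def using space_closed by (simp add: space_measure_of)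
qed

lemma sets_total_variation:
  assumes "signed_measure T \<T> \<mu>"
  shows "sets (total_variation T \<T> \<mu>) = \<T>"
proof -
  interpret sigma_algebra T \<T> using assms unfolding signed_measure_def by blast
  show ?thesis unfolding total_variation_def by simp
qed

lemma emeasure_total_variation:
  assumes \<mu>: "signed_measure T \<T> \<mu>" and A: "A \<in> \<T>"
  shows "emeasure (total_variation T \<T> \<mu>) A = variation \<T> \<mu> A"
proof -
  interpret sigma_algebra T \<T> using \<mu> unfolding signed_measure_def by blast
  have "{P. finite P \<and> P \<subseteq> \<T> \<and> partition_on {} P} = {{}}"
    by (auto simp: partition_on_def)
  then have "positive \<T> (variation \<T> \<mu>)"
    unfolding positive_def variation_def by simp
  then show ?thesis
    unfolding total_variation_def
    by (rule emeasure_measure_of_sigma[OF sigma_algebra_axioms _ variation_countably_additive[OF \<mu>] A])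
qed

text \<open>Real functions on \<^term>\<open>space N\<close> are represented by extensional functions.
  \<open>N\<close> is the total variation of the signed measure in all that follows.\<close>

definition bdd_integrable :: "'t measure \<Rightarrow> ('t \<Rightarrow> real) set" where
  "bdd_integrable N = {z \<in> extensional (space N). bounded (z ` space N) \<and> integrable N z}"

text \<open>The inserted 0 only matters for an empty \<^term>\<open>space N\<close>, where \<^term>\<open>Sup {} :: real\<close> is unspecified.\<close>

definition bi_norm :: "'t measure \<Rightarrow> ('t \<Rightarrow> real) \<Rightarrow> real" where
  "bi_norm N z = max (Sup (insert 0 ((\<lambda>t. \<bar>z t\<bar>) ` space N))) (\<integral>t. \<bar>z t\<bar> \<partial>N)"

definition bi_dist :: "'t measure \<Rightarrow> ('t \<Rightarrow> real) \<Rightarrow> ('t \<Rightarrow> real) \<Rightarrow> real" where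
  "bi_dist N z y = bi_norm N (\<lambda>t. z t - y t)"

definition bi_metric :: "'t measure \<Rightarrow> ('t \<Rightarrow> real) metric" where
  "bi_metric N = metric (bdd_integrable N, bi_dist N)"

abbreviation bi_topology :: "'t measure \<Rightarrow> ('t \<Rightarrow> real) topology" where
  "bi_topology N \<equiv> mtopology_of (bi_metric N)"

lemma Metric_space_bdd_integrable: "Metric_space (bdd_integrable N) (bi_dist N)"
proof
  show "0 \<le> bi_dist N x y" for x y
    unfolding bi_dist_def bi_norm_def by (simp add: le_max_iff_disj)
  show "bi_dist N x y = bi_dist N y x" for x y
    unfolding bi_dist_def bi_norm_def by (simp add: abs_minus_commute)
  have bdd: "bdd_above (insert 0 ((\<lambda>t. \<bar>x t - y t\<bar>) ` space N))"
    if xy: "x \<in> bdd_integrable N" "y \<in> bdd_integrable N" for x y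
  proof -
    have "\<exists>b. \<forall>t\<in>space N. \<bar>z t\<bar> \<le> b" if "z \<in> bdd_integrable N" for z
      using that unfolding bdd_integrable_def bounded_iff by auto
    with xy obtain b c where bc: "\<forall>t\<in>space N. \<bar>x t\<bar> \<le> b" "\<forall>t\<in>space N. \<bar>y t\<bar> \<le> c"
      by blast
    have "\<bar>x t - y t\<bar> \<le> max 0 (b + c)" if t: "t \<in> space N" for t
      using bspec[OF bc(1) t] bspec[OF bc(2) t] by linarith
    then show ?thesis
      by (intro bdd_aboveI[of _ "max 0 (b + c)"]) auto
  qed
  have le_sup: "\<bar>x t - y t\<bar> \<le> Sup (insert 0 ((\<lambda>t. \<bar>x t - y t\<bar>) ` space N))"
    if "x \<in> bdd_integrable N" "y \<in> bdd_integrable N" "t \<in> space N" for x y t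
    using bdd[OF that(1,2)] that(3) by (intro cSup_upper) auto
  show "bi_dist N x y = 0 \<longleftrightarrow> x = y" if xy: "x \<in> bdd_integrable N" "y \<in> bdd_integrable N" for x y
  proof
    assume "bi_dist N x y = 0"
    then have "Sup (insert 0 ((\<lambda>t. \<bar>x t - y t\<bar>) ` space N)) \<le> 0"
      unfolding bi_dist_def bi_norm_def by linarith
    then have "x t = y t" if "t \<in> space N" for t
      using le_sup[OF xy that] by linarith
    then show "x = y"
      using xy unfolding bdd_integrable_def by (auto intro: extensionalityI)
  next
    assume "x = y"
    then show "bi_dist N x y = 0"
      unfolding bi_dist_def bi_norm_def by (cases "space N = {}") (auto simp: image_constant_conv)
  qed
  show "bi_dist N x z \<le> bi_dist N x y + bi_dist N y z"
    if xyz: "x \<in> bdd_integrable N" "y \<in> bdd_integrable N" "z \<in> bdd_integrable N" for x y z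
  proof -
    let ?S = "\<lambda>x y. Sup (insert 0 ((\<lambda>t. \<bar>x t - y t\<bar>) ` space N))"
    let ?J = "\<lambda>x y. (\<integral>t. \<bar>x t - y t\<bar> \<partial>N)"
    have "?S x z \<le> ?S x y + ?S y z"
    proof (rule cSup_least, simp)
      fix r assume "r \<in> insert 0 ((\<lambda>t. \<bar>x t - z t\<bar>) ` space N)"
      then show "r \<le> ?S x y + ?S y z"
      proof
        assume "r = 0"
        moreover have "0 \<le> ?S x y" "0 \<le> ?S y z"
          using bdd xyz by (auto intro!: cSup_upper)
        ultimately show ?thesis by linarith
      next
        assume "r \<in> (\<lambda>t. \<bar>x t - z t\<bar>) ` space N"
        then obtain t where "t \<in> space N" "r = \<bar>x t - z t\<bar>" by auto
        then show ?thesis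
          using le_sup[OF xyz(1,2), of t] le_sup[OF xyz(2,3), of t] by linarith
      qed
    qed
    moreover have "?J x z \<le> ?J x y + ?J y z"
    proof -
      have int: "integrable N x" "integrable N y" "integrable N z"
        using xyz unfolding bdd_integrable_def by auto
      then have "?J x z \<le> (\<integral>t. \<bar>x t - y t\<bar> + \<bar>y t - z t\<bar> \<partial>N)"
        by (intro integral_mono) auto
      also have "\<dots> = ?J x y + ?J y z"
        using int by (intro Bochner_Integration.integral_add) auto
      finally show ?thesis .
    qed
    ultimately show ?thesis unfolding bi_dist_def bi_norm_def by linarith
  qed
qed

lemma mspace_bi_metric [simp]: "mspace (bi_metric N) = bdd_integrable N"
  unfolding bi_metric_def using Metric_space_bdd_integrable by (rule Metric_space.mspace_metric)

lemma mdist_bi_metric [simp]: "mdist (bi_metric N) = bi_dist N"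
  unfolding bi_metric_def using Metric_space_bdd_integrable by (rule Metric_space.mdist_metric)

definition directed_set :: "'i set \<Rightarrow> ('i \<Rightarrow> 'i \<Rightarrow> bool) \<Rightarrow> bool" where
  "directed_set I le \<longleftrightarrow>
     I \<noteq> {} \<and>
     (\<forall>\<alpha>\<in>I. le \<alpha> \<alpha>) \<and>
     (\<forall>\<alpha>\<in>I. \<forall>\<beta>\<in>I. \<forall>\<gamma>\<in>I. le \<alpha> \<beta> \<longrightarrow> le \<beta> \<gamma> \<longrightarrow> le \<alpha> \<gamma>) \<and>
     (\<forall>\<alpha>\<in>I. \<forall>\<beta>\<in>I. \<exists>\<gamma>\<in>I. le \<alpha> \<gamma> \<and> le \<beta> \<gamma>)"

definition net_filter :: "'i set \<Rightarrow> ('i \<Rightarrow> 'i \<Rightarrow> bool) \<Rightarrow> 'i filter" where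
  "net_filter I le = (INF \<alpha>\<in>I. principal {\<beta>\<in>I. le \<alpha> \<beta>})"

lemma eventually_net_filter:
  assumes "directed_set I le"
  shows "eventually Q (net_filter I le) \<longleftrightarrow> (\<exists>\<alpha>\<in>I. \<forall>\<beta>\<in>I. le \<alpha> \<beta> \<longrightarrow> Q \<beta>)"
proof -
  have "eventually Q (net_filter I le) \<longleftrightarrow> (\<exists>\<alpha>\<in>I. eventually Q (principal {\<beta>\<in>I. le \<alpha> \<beta>}))"
    unfolding net_filter_def
  proof (rule eventually_INF_base)
    show "I \<noteq> {}" using assms unfolding directed_set_def by blast
    fix \<alpha> \<beta> assume ab: "\<alpha> \<in> I" "\<beta> \<in> I"
    then obtain \<gamma> where \<gamma>: "\<gamma> \<in> I" "le \<alpha> \<gamma>" "le \<beta> \<gamma>"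
      using assms unfolding directed_set_def by blast
    have "{\<delta> \<in> I. le \<gamma> \<delta>} \<subseteq> {\<delta> \<in> I. le \<alpha> \<delta>} \<inter> {\<delta> \<in> I. le \<beta> \<delta>}"
      using assms ab \<gamma> unfolding directed_set_def by blast
    with \<gamma>(1) show "\<exists>x\<in>I. principal {\<beta> \<in> I. le x \<beta>} \<le> inf (principal {\<beta> \<in> I. le \<alpha> \<beta>}) (principal {\<beta>' \<in> I. le \<beta> \<beta>'})"
      by (auto intro!: bexI[of _ \<gamma>])
  qed
  then show ?thesis by (auto simp: eventually_principal)
qed

definition expectation_exists :: "'w measure \<Rightarrow> ('w \<Rightarrow> ereal) \<Rightarrow> bool" where
  "expectation_exists P U \<longleftrightarrow>
     (\<integral>\<^sup>+\<omega>. e2ennreal (U \<omega>) \<partial>P) \<noteq> \<infinity> \<or> (\<integral>\<^sup>+\<omega>. e2ennreal (- U \<omega>) \<partial>P) \<noteq> \<infinity>"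

text \<open>\<^const>\<open>e2ennreal\<close> sends negative numbers to 0, so this is \<open>E U\<^sup>+ - E U\<^sup>-\<close>.\<close>

definition ereal_expectation :: "'w measure \<Rightarrow> ('w \<Rightarrow> ereal) \<Rightarrow> ereal" where
  "ereal_expectation P U =
     enn2ereal (\<integral>\<^sup>+\<omega>. e2ennreal (U \<omega>) \<partial>P) - enn2ereal (\<integral>\<^sup>+\<omega>. e2ennreal (- U \<omega>) \<partial>P)"

definition outer_expectation :: "'w measure \<Rightarrow> ('w \<Rightarrow> real) \<Rightarrow> ereal" where
  "outer_expectation P f =
     Inf {ereal_expectation P U | U. U \<in> borel_measurable P \<and> expectation_exists P U \<and>
                                     (\<forall>\<omega>\<in>space P. ereal (f \<omega>) \<le> U \<omega>)}"

definition inner_prob :: "'w measure \<Rightarrow> 'w set \<Rightarrow> real" where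
  "inner_prob P B = (SUP A \<in> {A \<in> sets P. A \<subseteq> B}. measure P A)"

definition borel_of :: "'x topology \<Rightarrow> 'x measure" where
  "borel_of S = sigma (topspace S) {U. openin S U}"

definition net_weak_conv ::
    "'i filter \<Rightarrow> 'x topology \<Rightarrow> ('i \<Rightarrow> 'w measure) \<Rightarrow> ('i \<Rightarrow> 'w \<Rightarrow> 'x) \<Rightarrow> 'v measure \<Rightarrow> ('v \<Rightarrow> 'x) \<Rightarrow> bool" where
  "net_weak_conv F S P X Q Y \<longleftrightarrow>
     prob_space Q \<and> Y \<in> measurable Q (borel_of S) \<and>
     (\<forall>h. continuous_map S euclideanreal h \<longrightarrow> bounded (h ` topspace S) \<longrightarrow>
        ((\<lambda>\<alpha>. outer_expectation (P \<alpha>) (\<lambda>\<omega>. h (X \<alpha> \<omega>))) \<longlongrightarrow> ereal (\<integral>v. h (Y v) \<partial>Q)) F)"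

definition tight_map :: "'x topology \<Rightarrow> 'v measure \<Rightarrow> ('v \<Rightarrow> 'x) \<Rightarrow> bool" where
  "tight_map S Q Y \<longleftrightarrow>
     (\<forall>\<epsilon>>0. \<exists>K. compactin S K \<and> measure Q {v \<in> space Q. Y v \<in> K} \<ge> 1 - \<epsilon>)"

text \<open>The infimum is taken in \<^typ>\<open>ereal\<close>, so that the distance to the empty set is \<open>\<infinity>\<close>.\<close>

definition enlargement :: "'x metric \<Rightarrow> 'x set \<Rightarrow> real \<Rightarrow> 'x set" where
  "enlargement L K \<delta> = {z \<in> mspace L. (INF y\<in>K. ereal (mdist L z y)) < ereal \<delta>}"

definition asymp_tight ::
    "'i filter \<Rightarrow> 'x metric \<Rightarrow> ('i \<Rightarrow> 'w measure) \<Rightarrow> ('i \<Rightarrow> 'w \<Rightarrow> 'x) \<Rightarrow> bool" where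
  "asymp_tight F L P X \<longleftrightarrow>
     (\<forall>\<epsilon>>0. \<exists>K. compactin (mtopology_of L) K \<and>
        (\<forall>\<delta>>0. Liminf F (\<lambda>\<alpha>. ereal (inner_prob (P \<alpha>) {\<omega> \<in> space (P \<alpha>). X \<alpha> \<omega> \<in> enlargement L K \<delta>}))
                 \<ge> ereal (1 - \<epsilon>)))"

text \<open>\<^const>\<open>Euclidean_space\<close> represents points of \<open>\<real>\<^sup>k\<close> by sequences that vanish from index \<open>k\<close> on.\<close>

definition marginal :: "nat \<Rightarrow> (nat \<Rightarrow> 't) \<Rightarrow> ('t \<Rightarrow> real) \<Rightarrow> nat \<Rightarrow> real" where
  "marginal k t z = (\<lambda>i. if i < k then z (t i) else 0)"

text \<open>Existence of a limit may be stated with a limit variable on the type \<open>'x\<close> itself: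
  every limit, on whatever probability space, can be replaced by the identity under its law.\<close>

lemma space_borel_of [simp]: "space (borel_of S) = topspace S"
  unfolding borel_of_def by (rule space_measure_of) (auto dest: openin_subset)

lemma sets_borel_of: "sets (borel_of S) = sigma_sets (topspace S) {U. openin S U}"
  unfolding borel_of_def by (rule sets_measure_of) (auto dest: openin_subset)

lemma continuous_map_borel_of:
  assumes "continuous_map S euclideanreal h"
  shows "h \<in> borel_measurable (borel_of S)"
proof (rule borel_measurableI)
  fix U :: "real set" assume "open U"
  then have "openin S {x \<in> topspace S. h x \<in> U}"
    using assms by (intro openin_continuous_map_preimage[of _ euclideanreal]) auto
  moreover have "h -` U \<inter> space (borel_of S) = {x \<in> topspace S. h x \<in> U}" by auto
  ultimately show "h -` U \<inter> space (borel_of S) \<in> sets (borel_of S)"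
    unfolding sets_borel_of by auto
qed

lemma net_weak_conv_law:
  assumes wc: "net_weak_conv F S P X Q Y"
  shows "net_weak_conv F S P X (distr Q (borel_of S) Y) (\<lambda>x. x)"
proof -
  have Y: "Y \<in> measurable Q (borel_of S)" and "prob_space Q"
    using wc unfolding net_weak_conv_def by auto
  then have "prob_space (distr Q (borel_of S) Y)" by (intro prob_space.prob_space_distr)
  moreover have "(\<integral>x. h x \<partial>distr Q (borel_of S) Y) = (\<integral>v. h (Y v) \<partial>Q)"
    if "continuous_map S euclideanreal h" for h
    by (rule integral_distr[OF Y continuous_map_borel_of[OF that]])
  ultimately show ?thesis
    using wc unfolding net_weak_conv_def by simp
qed

lemma tight_map_law:
  assumes S: "Hausdorff_space S" and Y: "Y \<in> measurable Q (borel_of S)" and t: "tight_map S Q Y"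
  shows "tight_map S (distr Q (borel_of S) Y) (\<lambda>x. x)"
  unfolding tight_map_def
proof (intro allI impI)
  fix \<epsilon> :: real assume "\<epsilon> > 0"
  then obtain K where K: "compactin S K" "measure Q {v \<in> space Q. Y v \<in> K} \<ge> 1 - \<epsilon>"
    using t unfolding tight_map_def by blast
  have sub: "K \<subseteq> topspace S" using K(1) by (rule compactin_subset_topspace)
  have "closedin S K" using S K(1) by (rule compactin_imp_closedin)
  then have "topspace S - K \<in> sets (borel_of S)"
    unfolding sets_borel_of by (auto simp: closedin_def)
  then have "space (borel_of S) - (topspace S - K) \<in> sets (borel_of S)" by (rule sets.compl_sets)
  then have KB: "K \<in> sets (borel_of S)" using sub by (simp add: double_diff)
  have "{x \<in> space (distr Q (borel_of S) Y). x \<in> K} = K" using sub by auto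
  moreover have "measure (distr Q (borel_of S) Y) K = measure Q {v \<in> space Q. Y v \<in> K}"
    using measure_distr[OF Y KB] by (simp add: vimage_def Int_def conj_commute)
  ultimately show "\<exists>K. compactin S K \<and> 1 - \<epsilon> \<le> measure (distr Q (borel_of S) Y) {x \<in> space (distr Q (borel_of S) Y). x \<in> K}"
    using K by auto
qed

end

theory Submission
  imports Defs
begin

text \<open>
  Asymptotic tightness supplies compact sets \<open>K\<^sub>n\<close> that carry the net up to \<open>1/n\<close>, and countably many
  coordinates \<open>S \<subseteq> T\<close> separate the points of \<open>\<Union>\<^sub>n K\<^sub>n\<close>. If \<open>Y\<close> is a process to whose marginals those of the
  net converge, then testing the marginals with Lipschitz bumps around the projections of \<open>K\<^sub>n\<close> shows that almost
  surely \<open>Y\<close> agrees on \<open>S\<close> with a point of some \<open>K\<^sub>n\<close>. That point is unique, it is the version of \<open>Y\<close>, and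
  enlarging \<open>S\<close> by one coordinate \<open>t\<close> shows that it also agrees almost surely with \<open>Y\<close> at \<open>t\<close>.
  A continuous \<open>h\<close> is approximated on \<open>K\<^sub>n\<close>, hence near \<open>K\<^sub>n\<close>, by a McShane extension that depends on finitely
  many coordinates only, so convergence of the marginals gives weak convergence. When only the marginal limits are
  given, they are consistent, and Kolmogorov's theorem provides the process \<open>Y\<close>; no compactness theorem for
  measures is needed.
\<close>

subsection \<open>Outer expectation and inner probability\<close>

text \<open>The maps X_\<alpha> need not be measurable, so integrals are replaced by outer
  expectations, which are not additive. Two test functions are therefore compared through
  \<open>outer_expectation_le_add\<close>, which charges 2b for whatever inner probability misses.
  This is the origin of the factor 2 in bounds such as \<open>1 - 2 * \<epsilon>\<close>; it is
  harmless because \<epsilon> is arbitrary. Since T may be uncountable, no single null set need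
  serve all coordinates: each t contributes its own. That the version is nevertheless chosen once,
  independently of t, rests on separation over the whole union of the compact sets and not within
  each of them. The metric space need not be separable, so Borel measurability of the version cannot
  simply be read off its coordinates; it comes from intersecting closed sets with the compact ones.
  The argument runs for any metric on real functions that dominates every coordinate difference and
  whose points are determined by their coordinates.\<close>

lemma ereal_expectation_ereal:
  assumes "integrable P u"
  shows "expectation_exists P (\<lambda>\<omega>. ereal (u \<omega>))"
    and "ereal_expectation P (\<lambda>\<omega>. ereal (u \<omega>)) = ereal (\<integral>\<omega>. u \<omega> \<partial>P)"
proof -
  obtain r q where "0 \<le> r" "0 \<le> q" "(\<integral>\<^sup>+\<omega>. ennreal (u \<omega>) \<partial>P) = ennreal r"
    "(\<integral>\<^sup>+\<omega>. ennreal (- u \<omega>) \<partial>P) = ennreal q" "(\<integral>\<omega>. u \<omega> \<partial>P) = r - q"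
    using assms by (rule integrableE)
  then show "expectation_exists P (\<lambda>\<omega>. ereal (u \<omega>))"
    and "ereal_expectation P (\<lambda>\<omega>. ereal (u \<omega>)) = ereal (\<integral>\<omega>. u \<omega> \<partial>P)"
    unfolding expectation_exists_def ereal_expectation_def by (simp_all add: enn2ereal_ennreal)
qed

lemma ereal_expectation_mono:
  assumes "\<And>\<omega>. \<omega> \<in> space P \<Longrightarrow> U \<omega> \<le> V \<omega>"
  shows "ereal_expectation P U \<le> ereal_expectation P V"
  unfolding ereal_expectation_def using assms
  by (intro ereal_minus_mono) (auto simp flip: less_eq_ennreal.rep_eq intro!: nn_integral_mono e2ennreal_mono)

lemma outer_expectation_le_integral:
  assumes "integrable P u" "\<And>\<omega>. \<omega> \<in> space P \<Longrightarrow> f \<omega> \<le> u \<omega>"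
  shows "outer_expectation P f \<le> ereal (\<integral>\<omega>. u \<omega> \<partial>P)"
  unfolding outer_expectation_def using assms ereal_expectation_ereal[OF assms(1)]
  by (intro Inf_lower CollectI exI[of _ "\<lambda>\<omega>. ereal (u \<omega>)"]) auto

context prob_space
begin

lemma bounded_integrable:
  fixes u :: "'a \<Rightarrow> real"
  assumes "u \<in> borel_measurable M" "\<And>\<omega>. \<omega> \<in> space M \<Longrightarrow> \<bar>u \<omega>\<bar> \<le> b"
  shows "integrable M u"
  using assms by (intro integrable_const_bound[of _ b]) auto

text \<open>A nearly optimal majorant may be truncated to [-b, b]. It stays above f, whose values
  lie there, and the truncation does not raise it: \<open>U\<close> is already at least -b, so only
  the cut at b has an effect. The result is real-valued and integrable.\<close>

lemma outer_expectation_lessE: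
  assumes f: "\<And>\<omega>. \<omega> \<in> space M \<Longrightarrow> \<bar>f \<omega>\<bar> \<le> b" and c: "outer_expectation M f < c"
  obtains u where "u \<in> borel_measurable M" "\<And>\<omega>. \<omega> \<in> space M \<Longrightarrow> f \<omega> \<le> u \<omega>"
    "\<And>\<omega>. \<omega> \<in> space M \<Longrightarrow> \<bar>u \<omega>\<bar> \<le> b" "ereal (\<integral>\<omega>. u \<omega> \<partial>M) < c"
proof -
  obtain U where [measurable]: "U \<in> borel_measurable M" and fU: "\<forall>\<omega>\<in>space M. ereal (f \<omega>) \<le> U \<omega>"
    and Uc: "ereal_expectation M U < c"
    using c unfolding outer_expectation_def Inf_less_iff by auto
  define u where "u \<omega> = real_of_ereal (max (ereal (-b)) (min (U \<omega>) (ereal b)))" for \<omega>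
  have ereal_u: "ereal (u \<omega>) = max (ereal (-b)) (min (U \<omega>) (ereal b))" for \<omega>
    unfolding u_def by (cases "U \<omega>") (auto simp: max_def min_def)
  have um [measurable]: "u \<in> borel_measurable M" unfolding u_def by measurable
  have fu: "f \<omega> \<le> u \<omega>" "\<bar>u \<omega>\<bar> \<le> b" "ereal (u \<omega>) \<le> U \<omega>" if "\<omega> \<in> space M" for \<omega>
  proof -
    have *: "ereal (f \<omega>) \<le> U \<omega>" "- b \<le> f \<omega>" "f \<omega> \<le> b" using fU f[OF that] that by auto
    then have "ereal (- b) \<le> U \<omega>" by (meson ereal_less_eq(3) order_trans)
    then show "ereal (u \<omega>) \<le> U \<omega>" unfolding ereal_u by simp
    have "ereal (f \<omega>) \<le> ereal (u \<omega>)" unfolding ereal_u using * by (simp add: le_max_iff_disj)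
    then show "f \<omega> \<le> u \<omega>" by simp
    have "ereal (- b) \<le> ereal (u \<omega>)" "ereal (u \<omega>) \<le> ereal b"
      unfolding ereal_u using * by (auto simp: le_max_iff_disj)
    then show "\<bar>u \<omega>\<bar> \<le> b" by simp
  qed
  have "ereal (\<integral>\<omega>. u \<omega> \<partial>M) = ereal_expectation M (\<lambda>\<omega>. ereal (u \<omega>))"
    using fu by (intro ereal_expectation_ereal(2)[symmetric] bounded_integrable[of _ b]) auto
  also have "\<dots> \<le> ereal_expectation M U" using fu(3) by (rule ereal_expectation_mono)
  also have "\<dots> < c" by (rule Uc)
  finally show ?thesis using that um fu by blast
qed

text \<open>Boundedness keeps the value finite: the constant b is a majorant, and a value below -b
  would yield a majorant bounded below by -b with a smaller integral. Later estimates can thus be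
  made in the reals.\<close>

lemma outer_expectation_ereal:
  assumes f: "\<And>\<omega>. \<omega> \<in> space M \<Longrightarrow> \<bar>f \<omega>\<bar> \<le> b"
  shows "outer_expectation M f = ereal (real_of_ereal (outer_expectation M f))"
proof -
  have "outer_expectation M f \<le> ereal (\<integral>\<omega>. b \<partial>M)"
    using f by (intro outer_expectation_le_integral) (auto simp: abs_le_iff)
  moreover have "ereal (- b) \<le> outer_expectation M f"
  proof (rule ccontr)
    assume "\<not> ereal (- b) \<le> outer_expectation M f"
    then obtain u where u: "u \<in> borel_measurable M" "\<And>\<omega>. \<omega> \<in> space M \<Longrightarrow> \<bar>u \<omega>\<bar> \<le> b"
      "(\<integral>\<omega>. u \<omega> \<partial>M) < - b"
      using outer_expectation_lessE[of f b "ereal (- b)"] f by (metis ereal_less(2) less_ereal.simps(1) not_le)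
    have "(\<integral>\<omega>. - b \<partial>M) \<le> (\<integral>\<omega>. u \<omega> \<partial>M)"
      using u by (intro integral_mono bounded_integrable[of u b]) (auto simp: abs_le_iff minus_le_iff)
    with u(3) show False by (simp add: prob_space)
  qed
  ultimately show ?thesis by (cases "outer_expectation M f") auto
qed

lemma inner_prob_upper: "A \<in> events \<Longrightarrow> A \<subseteq> B \<Longrightarrow> prob A \<le> inner_prob M B"
  unfolding inner_prob_def by (intro cSUP_upper bdd_aboveI[of _ 1]) auto

lemma inner_prob_least: "(\<And>A. A \<in> events \<Longrightarrow> A \<subseteq> B \<Longrightarrow> prob A \<le> c) \<Longrightarrow> inner_prob M B \<le> c"
  unfolding inner_prob_def by (intro cSUP_least) auto

text \<open>For a measurable A inside B, a nearly optimal majorant u of g becomes a majorant of f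
  after adding \<eta> and, off A, the amount 2b: there f is at most b and u at least -b. The
  correction is measurable, so its integral can be split off.\<close>

lemma outer_expectation_le_add:
  assumes b: "0 < b"
    and f: "\<And>\<omega>. \<omega> \<in> space M \<Longrightarrow> \<bar>f \<omega>\<bar> \<le> b" and g: "\<And>\<omega>. \<omega> \<in> space M \<Longrightarrow> \<bar>g \<omega>\<bar> \<le> b"
    and fg: "\<And>\<omega>. \<omega> \<in> space M \<Longrightarrow> \<omega> \<in> B \<Longrightarrow> f \<omega> \<le> g \<omega> + \<eta>" and \<eta>: "0 \<le> \<eta>"
  shows "real_of_ereal (outer_expectation M f)
    \<le> real_of_ereal (outer_expectation M g) + \<eta> + 2 * b * (1 - inner_prob M B)"
proof -
  let ?f = "real_of_ereal (outer_expectation M f)" and ?g = "real_of_ereal (outer_expectation M g)"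
  have A: "?f \<le> ?g + \<eta> + 2 * b * (1 - prob A)" if [measurable]: "A \<in> events" and AB: "A \<subseteq> B" for A
  proof (rule field_le_epsilon)
    fix e :: real assume "0 < e"
    then have "outer_expectation M g < ereal (?g + e)"
      using outer_expectation_ereal[of g b] g by (metis ereal_less(2) less_add_same_cancel1 less_ereal.simps(1))
    with g obtain u where u[measurable]: "u \<in> borel_measurable M" and gu: "\<And>\<omega>. \<omega> \<in> space M \<Longrightarrow> g \<omega> \<le> u \<omega>"
      and ub: "\<And>\<omega>. \<omega> \<in> space M \<Longrightarrow> \<bar>u \<omega>\<bar> \<le> b" and ue: "(\<integral>\<omega>. u \<omega> \<partial>M) < ?g + e"
      using outer_expectation_lessE[of g b "ereal (?g + e)"] by (metis less_ereal.simps(1))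
    note [simp] = bounded_integrable[OF u ub]
    let ?v = "\<lambda>\<omega>. u \<omega> + (\<eta> + 2 * b * (1 - indicator A \<omega>))"
    have "outer_expectation M f \<le> ereal (\<integral>\<omega>. ?v \<omega> \<partial>M)"
    proof (rule outer_expectation_le_integral)
      show "integrable M ?v" by (auto intro!: integrable_real_indicator simp: emeasure_eq_measure)
      show "f \<omega> \<le> ?v \<omega>" if "\<omega> \<in> space M" for \<omega>
        using fg[OF that] gu[OF that] ub[OF that] f[OF that] AB \<eta> by (cases "\<omega> \<in> A") auto
    qed
    also have "(\<integral>\<omega>. ?v \<omega> \<partial>M) = (\<integral>\<omega>. u \<omega> \<partial>M) + (\<eta> + 2 * b * (1 - prob A))"
      by (simp add: prob_space emeasure_eq_measure)
    finally have "ereal ?f \<le> ereal ((\<integral>\<omega>. u \<omega> \<partial>M) + (\<eta> + 2 * b * (1 - prob A)))"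
      using outer_expectation_ereal[of f b] f by simp
    with ue show "?f \<le> ?g + \<eta> + 2 * b * (1 - prob A) + e" by simp
  qed
  \<comment> \<open>Solved for \<open>prob A\<close>, the estimate has a right-hand side independent
    of A, so it passes to the supremum over A.\<close>
  have "inner_prob M B \<le> 1 - (?f - ?g - \<eta>) / (2 * b)"
  proof (rule inner_prob_least)
    fix A assume "A \<in> events" "A \<subseteq> B"
    from A[OF this] b show "prob A \<le> 1 - (?f - ?g - \<eta>) / (2 * b)" by (simp add: field_simps)
  qed
  with b show ?thesis by (simp add: field_simps)
qed

text \<open>The left side is the inner expectation of h. If u is a measurable majorant of -h with
  values in [-1, 1], then {u < 0} is a measurable subset of B, and u is at least minus the indicator
  of that set.\<close>

lemma inner_prob_ge_outer_expectation:
  assumes h: "\<And>\<omega>. \<omega> \<in> space M \<Longrightarrow> 0 \<le> h \<omega> \<and> h \<omega> \<le> 1"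
    and hB: "\<And>\<omega>. \<omega> \<in> space M \<Longrightarrow> 0 < h \<omega> \<Longrightarrow> \<omega> \<in> B"
  shows "- real_of_ereal (outer_expectation M (\<lambda>\<omega>. - h \<omega>)) \<le> inner_prob M B"
proof (rule field_le_epsilon)
  let ?f = "real_of_ereal (outer_expectation M (\<lambda>\<omega>. - h \<omega>))"
  fix e :: real assume "0 < e"
  have b: "\<bar>- h \<omega>\<bar> \<le> 1" if "\<omega> \<in> space M" for \<omega> using h[OF that] by simp
  have "outer_expectation M (\<lambda>\<omega>. - h \<omega>) < ereal (?f + e)"
    using outer_expectation_ereal[of "\<lambda>\<omega>. - h \<omega>" 1] b \<open>0 < e\<close>
    by (metis less_add_same_cancel1 less_ereal.simps(1))
  then obtain u where u[measurable]: "u \<in> borel_measurable M" and hu: "\<And>\<omega>. \<omega> \<in> space M \<Longrightarrow> - h \<omega> \<le> u \<omega>"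
    and ub: "\<And>\<omega>. \<omega> \<in> space M \<Longrightarrow> \<bar>u \<omega>\<bar> \<le> 1" and ue: "(\<integral>\<omega>. u \<omega> \<partial>M) < ?f + e"
    using outer_expectation_lessE[of "\<lambda>\<omega>. - h \<omega>" 1 "ereal (?f + e)"] b by (metis less_ereal.simps(1))
  let ?A = "{\<omega>\<in>space M. u \<omega> < 0}"
  have A[measurable]: "?A \<in> events" by measurable
  have "?A \<subseteq> B" using hu hB by force
  then have "prob ?A \<le> inner_prob M B" using A by (intro inner_prob_upper)
  moreover have "(\<integral>\<omega>. - indicator ?A \<omega> \<partial>M) \<le> (\<integral>\<omega>. u \<omega> \<partial>M)"
  proof (rule integral_mono)
    show "integrable M u" by (rule bounded_integrable[OF u ub])
    show "integrable M (\<lambda>\<omega>. - indicator ?A \<omega> :: real)"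
      by (auto intro!: integrable_real_indicator simp: emeasure_eq_measure)
    show "- indicator ?A \<omega> \<le> u \<omega>" if "\<omega> \<in> space M" for \<omega>
      using ub[OF that] that by (auto simp: indicator_def)
  qed
  ultimately show "- ?f \<le> inner_prob M B + e" using ue by simp
qed

end

subsection \<open>Lipschitz functions of finitely many coordinates\<close>

lemma Lim_null_le_inverse_Suc:
  fixes f :: "nat \<Rightarrow> real"
  assumes "eventually (\<lambda>n. \<bar>f n\<bar> \<le> 1 / real (Suc n)) sequentially"
  shows "f \<longlonglongrightarrow> 0"
  by (rule Lim_null_comparison[OF assms[folded real_norm_def]])
     (rule LIMSEQ_inverse_real_of_nat[unfolded inverse_eq_divide])

text \<open>Continuity at x is inherited from a continuous bound that vanishes at x. It serves for
  product topologies over arbitrary index types.\<close>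

lemma continuous_map_real_squeeze:
  assumes "\<And>x. x \<in> topspace S \<Longrightarrow> \<exists>c. continuous_map S euclideanreal c \<and> c x = 0 \<and>
             (\<forall>y\<in>topspace S. \<bar>h y - h x\<bar> \<le> c y)"
  shows "continuous_map S euclideanreal h"
  unfolding continuous_map_atin
proof
  fix x assume x: "x \<in> topspace S"
  from assms[OF x] obtain c where c: "continuous_map S euclideanreal c" "c x = 0"
    and h: "\<forall>y\<in>topspace S. \<bar>h y - h x\<bar> \<le> c y" by blast
  have "(c \<longlongrightarrow> 0) (atin S x)" using c x unfolding continuous_map_atin by auto
  moreover have "eventually (\<lambda>y. norm (h y - h x) \<le> c y) (atin S x)"
    using h x by (auto simp: eventually_atin intro!: exI[of _ "topspace S"])
  ultimately have "((\<lambda>y. h y - h x) \<longlongrightarrow> 0) (atin S x)" by (rule Lim_null_comparison[rotated])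
  then show "limitin euclideanreal h (h x) (atin S x)" by (simp add: Lim_null[symmetric])
qed

text \<open>The infimal convolution of \<open>h\<close> with a multiple of a pseudometric is McShane's Lipschitz extension.\<close>

definition inf_conv :: "'b set \<Rightarrow> ('b \<Rightarrow> real) \<Rightarrow> ('a \<Rightarrow> 'b \<Rightarrow> real) \<Rightarrow> 'a \<Rightarrow> real" where
  "inf_conv K h \<rho> z = (INF y\<in>K. h y + \<rho> z y)"

lemma inf_conv_le:
  assumes "\<And>y. y \<in> K \<Longrightarrow> b \<le> h y" "\<And>y. y \<in> K \<Longrightarrow> 0 \<le> \<rho> z y" "y \<in> K"
  shows "inf_conv K h \<rho> z \<le> h y + \<rho> z y"
  unfolding inf_conv_def using assms
  by (intro cINF_lower bdd_belowI2[of _ b]) (auto intro: add_increasing2)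

lemma inf_conv_ge:
  assumes "K \<noteq> {}" "\<And>y. y \<in> K \<Longrightarrow> c \<le> h y + \<rho> z y"
  shows "c \<le> inf_conv K h \<rho> z"
  unfolding inf_conv_def using assms by (intro cINF_greatest)

text \<open>Both infima run over the same K, and corresponding terms differ by at most D.\<close>

lemma inf_conv_diff:
  assumes K: "K \<noteq> {}" and b: "\<And>y. y \<in> K \<Longrightarrow> b \<le> h y"
    and \<rho>: "\<And>y. y \<in> K \<Longrightarrow> 0 \<le> \<rho> z y" "\<And>y. y \<in> K \<Longrightarrow> 0 \<le> \<rho> w y"
      "\<And>y. y \<in> K \<Longrightarrow> \<rho> z y \<le> D + \<rho> w y" "\<And>y. y \<in> K \<Longrightarrow> \<rho> w y \<le> D + \<rho> z y"
  shows "\<bar>inf_conv K h \<rho> z - inf_conv K h \<rho> w\<bar> \<le> D"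
proof -
  have "inf_conv K h \<rho> z - D \<le> inf_conv K h \<rho> w"
    using inf_conv_le[of K b h \<rho> z] K b \<rho> by (intro inf_conv_ge) fastforce+
  moreover have "inf_conv K h \<rho> w - D \<le> inf_conv K h \<rho> z"
    using inf_conv_le[of K b h \<rho> w] K b \<rho> by (intro inf_conv_ge) fastforce+
  ultimately show ?thesis by linarith
qed

definition coord_dist :: "'t set \<Rightarrow> ('t \<Rightarrow> real) \<Rightarrow> ('t \<Rightarrow> real) \<Rightarrow> real" where
  "coord_dist J z y = (\<Sum>t\<in>J. \<bar>z t - y t\<bar>)"

lemma coord_dist_nonneg: "0 \<le> coord_dist J z y"
  unfolding coord_dist_def by (simp add: sum_nonneg)

lemma coord_dist_self [simp]: "coord_dist J z z = 0"
  unfolding coord_dist_def by simp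

lemma coord_dist_commute: "coord_dist J z y = coord_dist J y z"
  unfolding coord_dist_def by (simp add: abs_minus_commute)

lemma coord_dist_triangle: "coord_dist J z y \<le> coord_dist J z w + coord_dist J w y"
  unfolding coord_dist_def sum.distrib[symmetric] by (intro sum_mono) linarith

lemma coord_dist_mono: "finite J' \<Longrightarrow> J \<subseteq> J' \<Longrightarrow> coord_dist J z y \<le> coord_dist J' z y"
  unfolding coord_dist_def by (intro sum_mono2) auto

lemma coord_dist_ge: "finite J \<Longrightarrow> t \<in> J \<Longrightarrow> \<bar>z t - y t\<bar> \<le> coord_dist J z y"
  unfolding coord_dist_def by (rule member_le_sum) auto

text \<open>The arguments are arbitrary functions, so that one and the same g can be evaluated at
  points of the metric space and at paths of a process outside it. That g sees only the coordinates
  in J is a consequence, \<open>coord_lipschitz_cong\<close>.\<close>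

definition coord_lipschitz :: "'t set \<Rightarrow> real \<Rightarrow> (('t \<Rightarrow> real) \<Rightarrow> real) \<Rightarrow> bool" where
  "coord_lipschitz J C g \<longleftrightarrow> 0 \<le> C \<and> (\<forall>z y. \<bar>g z - g y\<bar> \<le> C * coord_dist J z y)"

lemma coord_lipschitzD: "coord_lipschitz J C g \<Longrightarrow> \<bar>g z - g y\<bar> \<le> C * coord_dist J z y"
  unfolding coord_lipschitz_def by blast

lemma coord_lipschitz_cong:
  assumes "coord_lipschitz J C g" "\<And>t. t \<in> J \<Longrightarrow> z t = y t"
  shows "g z = g y"
  using coord_lipschitzD[OF assms(1), of z y] assms(2) by (simp add: coord_dist_def)

lemma coord_lipschitz_inf_conv:
  assumes "K \<noteq> {}" "\<And>y. y \<in> K \<Longrightarrow> b \<le> h y" "0 \<le> C"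
  shows "coord_lipschitz J C (inf_conv K h (\<lambda>z y. C * coord_dist J z y))"
  unfolding coord_lipschitz_def
proof (intro conjI allI)
  fix z w
  have "coord_dist J z y \<le> coord_dist J z w + coord_dist J w y"
    "coord_dist J w y \<le> coord_dist J z w + coord_dist J z y" for y
    using coord_dist_triangle[of J z y w] coord_dist_triangle[of J w y z] by (simp_all add: coord_dist_commute)
  with assms show "\<bar>inf_conv K h (\<lambda>z y. C * coord_dist J z y) z - inf_conv K h (\<lambda>z y. C * coord_dist J z y) w\<bar>
    \<le> C * coord_dist J z w"
    by (intro inf_conv_diff) (auto simp: coord_dist_nonneg simp flip: distrib_left intro: mult_left_mono)
qed (fact assms)

lemma coord_lipschitz_compose:
  assumes g: "coord_lipschitz J C g" and \<phi>: "\<And>x y. \<bar>\<phi> x - \<phi> y\<bar> \<le> c * \<bar>x - y\<bar>" and c: "0 \<le> c"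
  shows "coord_lipschitz J (c * C) (\<lambda>z. \<phi> (g z))"
  unfolding coord_lipschitz_def
proof (intro conjI allI)
  show "\<bar>\<phi> (g z) - \<phi> (g y)\<bar> \<le> c * C * coord_dist J z y" for z y
    using order_trans[OF \<phi> mult_left_mono[OF coord_lipschitzD[OF g] c], of z y] by (simp add: mult.assoc)
qed (use g c in \<open>simp add: coord_lipschitz_def\<close>)

text \<open>The slope 2b/\<gamma> makes the penalty at coordinate distance \<gamma> equal to 2b, the
  largest possible oscillation of h; at smaller distances h itself varies by at most \<eta>. So the
  infimum at a point of K loses at most \<eta>. It is at least -b by itself, and the minimum with b
  bounds it from above.\<close>

lemma min_inf_conv_approx:
  fixes h :: "('t \<Rightarrow> real) \<Rightarrow> real"
  assumes K: "K \<noteq> {}" and b: "0 < b" "\<And>y. y \<in> K \<Longrightarrow> \<bar>h y\<bar> \<le> b" and \<gamma>: "0 < \<gamma>"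
    and h: "\<And>z y. z \<in> K \<Longrightarrow> y \<in> K \<Longrightarrow> coord_dist J z y < \<gamma> \<Longrightarrow> \<bar>h z - h y\<bar> \<le> \<eta>" and \<eta>: "0 \<le> \<eta>"
  obtains g where "coord_lipschitz J (2 * b / \<gamma>) g" "\<And>z. \<bar>g z\<bar> \<le> b" "\<And>z. z \<in> K \<Longrightarrow> \<bar>g z - h z\<bar> \<le> \<eta>"
proof
  let ?C = "2 * b / \<gamma>"
  let ?i = "inf_conv K h (\<lambda>z y. ?C * coord_dist J z y)"
  let ?g = "\<lambda>z. min b (?i z)"
  have hb: "- b \<le> h y" "h y \<le> b" if "y \<in> K" for y using b(2)[OF that] by auto
  have C: "0 < ?C" using b \<gamma> by simp
  have "coord_lipschitz J (1 * ?C) ?g"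
  proof (rule coord_lipschitz_compose[where \<phi> = "min b"])
    show "coord_lipschitz J ?C ?i"
      using K C hb by (intro coord_lipschitz_inf_conv) auto
  qed auto
  then show "coord_lipschitz J ?C ?g" by simp
  have "- b \<le> ?i z" for z
    using K hb C by (intro inf_conv_ge) (auto intro!: add_increasing2 mult_nonneg_nonneg simp: coord_dist_nonneg b(1) less_imp_le \<gamma>)
  then show "\<bar>?g z\<bar> \<le> b" for z using b(1) by (simp add: abs_le_iff min_def) (smt (verit))
  fix z assume z: "z \<in> K"
  have "?i z \<le> h z + ?C * coord_dist J z z"
    using hb z C by (intro inf_conv_le[of K "- b" h "\<lambda>z y. ?C * coord_dist J z y"])
      (auto simp: coord_dist_nonneg b(1) less_imp_le \<gamma>)
  moreover have "h z - \<eta> \<le> ?i z"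
  proof (rule inf_conv_ge[OF K])
    fix y assume y: "y \<in> K"
    show "h z - \<eta> \<le> h y + ?C * coord_dist J z y"
    proof (cases "coord_dist J z y < \<gamma>")
      case True
      then have "h z - \<eta> \<le> h y" using h[OF z y] by linarith
      then show ?thesis using C coord_dist_nonneg[of J z y] by (smt (verit) mult_nonneg_nonneg)
    next
      case False
      then have "?C * \<gamma> \<le> ?C * coord_dist J z y" using C by (intro mult_left_mono) auto
      then show ?thesis using hb[OF z] hb[OF y] \<gamma> \<eta> by simp
    qed
  qed
  ultimately show "\<bar>?g z - h z\<bar> \<le> \<eta>" using hb[OF z] \<eta> by auto
qed

text \<open>Exhausts a countable, possibly finite, set by an increasing sequence of finite sets; t
  enters as soon as m exceeds its number.\<close>

definition initial_coords :: "'t set \<Rightarrow> nat \<Rightarrow> 't set" where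
  "initial_coords S m = {t \<in> S. to_nat_on S t < m}"

lemma finite_initial_coords: "countable S \<Longrightarrow> finite (initial_coords S m)"
  by (rule inj_on_finite[of "to_nat_on S" _ "{..<m}"])
     (auto simp: initial_coords_def intro: inj_on_subset[OF inj_on_to_nat_on])

lemma initial_coords_mono: "m \<le> n \<Longrightarrow> initial_coords S m \<subseteq> initial_coords S n"
  unfolding initial_coords_def by auto

lemma initial_coords_subset: "initial_coords S m \<subseteq> S"
  unfolding initial_coords_def by auto

text \<open>The l1 distance between the projections of x and of K to the first m coordinates of
  S.\<close>

definition gap :: "('t \<Rightarrow> real) set \<Rightarrow> 't set \<Rightarrow> nat \<Rightarrow> ('t \<Rightarrow> real) \<Rightarrow> real" where
  "gap K S m = inf_conv K (\<lambda>_. 0) (coord_dist (initial_coords S m))"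

lemma coord_lipschitz_gap: "K \<noteq> {} \<Longrightarrow> coord_lipschitz (initial_coords S m) 1 (gap K S m)"
  using coord_lipschitz_inf_conv[of K 0 "\<lambda>_. 0" 1 "initial_coords S m"] unfolding gap_def by simp

lemma gap_nonneg: "K \<noteq> {} \<Longrightarrow> 0 \<le> gap K S m x"
  unfolding gap_def by (intro inf_conv_ge) (auto simp: coord_dist_nonneg)

lemma gap_le: "y \<in> K \<Longrightarrow> gap K S m x \<le> coord_dist (initial_coords S m) x y"
  unfolding gap_def using inf_conv_le[of K 0 "\<lambda>_. 0" "coord_dist (initial_coords S m)" x y] by (simp add: coord_dist_nonneg)

lemma gap_mono:
  assumes "K \<noteq> {}" "countable S" "m \<le> n"
  shows "gap K S m x \<le> gap K S n x"
proof -
  have "gap K S m x \<le> coord_dist (initial_coords S n) x y" if "y \<in> K" for y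
    using gap_le[OF that, of S m x] coord_dist_mono[OF finite_initial_coords[OF assms(2)] initial_coords_mono[OF assms(3)], of x y]
    by linarith
  then show ?thesis unfolding gap_def[of K S n] using assms by (intro inf_conv_ge) auto
qed

subsection \<open>Metric spaces of functions\<close>

text \<open>The abstraction of L_\<mu>: the supremum part of the norm makes every coordinate
  1-Lipschitz, and extensionality makes the coordinates separate points.\<close>

locale function_metric = Metric_space M d for M :: "('t \<Rightarrow> real) set" and d +
  fixes T :: "'t set"
  assumes coord_le: "z \<in> M \<Longrightarrow> y \<in> M \<Longrightarrow> t \<in> T \<Longrightarrow> \<bar>z t - y t\<bar> \<le> d z y"
    and coords_separate: "z \<in> M \<Longrightarrow> y \<in> M \<Longrightarrow> (\<And>t. t \<in> T \<Longrightarrow> z t = y t) \<Longrightarrow> z = y"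
begin

lemma coord_dist_le:
  assumes "J \<subseteq> T" "z \<in> M" "y \<in> M"
  shows "coord_dist J z y \<le> real (card J) * d z y"
  unfolding coord_dist_def using coord_le assms by (intro sum_bounded_above) auto

lemma tendsto_coord:
  assumes "limitin mtopology \<sigma> l sequentially" "range \<sigma> \<subseteq> M" "t \<in> T"
  shows "(\<lambda>n. \<sigma> n t) \<longlonglongrightarrow> l t"
proof -
  have l: "l \<in> M" "(\<lambda>n. d (\<sigma> n) l) \<longlonglongrightarrow> 0"
    using assms(1) unfolding limitin_metric_dist_null by auto
  have "eventually (\<lambda>n. norm (\<sigma> n t - l t) \<le> d (\<sigma> n) l) sequentially"
    using assms(2,3) l(1) by (intro always_eventually) (auto intro!: coord_le simp: image_subset_iff)
  then have "(\<lambda>n. \<sigma> n t - l t) \<longlonglongrightarrow> 0" using l(2) by (rule Lim_null_comparison)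
  then show ?thesis by (simp add: Lim_null[symmetric])
qed

lemma compactinE:
  assumes "compactin mtopology K" "\<And>n::nat. \<sigma> n \<in> K"
  obtains l r where "l \<in> K" "strict_mono r" "limitin mtopology (\<sigma> \<circ> r) l sequentially"
  using assms unfolding compactin_sequentially by (metis image_subsetI)

lemma compactin_subset: "compactin mtopology K \<Longrightarrow> K \<subseteq> M"
  using compactin_subset_topspace by force

text \<open>Total boundedness gives a countable dense subset of each \<open>K n\<close>. For two
  dense points and a rational q, one coordinate is recorded at which they differ by more than q, if
  there is any. Countably many coordinates arise, and they separate all points of the union by
  approximation.\<close>

lemma countable_separating_coords:
  assumes K: "\<And>n::nat. compactin mtopology (K n)"
  shows "\<exists>S. countable S \<and> S \<subseteq> T \<and>
    (\<forall>z\<in>\<Union>(range K). \<forall>y\<in>\<Union>(range K). (\<forall>t\<in>S. z t = y t) \<longrightarrow> z = y)"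
proof -
  have "\<exists>D. countable D \<and> D \<subseteq> K n \<and> (\<forall>z\<in>K n. \<forall>e>0. \<exists>a\<in>D. d a z < e)" for n
  proof -
    have "\<forall>e>0. \<exists>F. finite F \<and> F \<subseteq> K n \<and> K n \<subseteq> (\<Union>x\<in>F. mball x e)"
      using compactin_imp_mtotally_bounded[OF K] unfolding mtotally_bounded_def by blast
    then obtain F where F: "\<And>e. 0 < e \<Longrightarrow> finite (F e) \<and> F e \<subseteq> K n \<and> K n \<subseteq> (\<Union>x\<in>F e. mball x e)"
      by metis
    let ?D = "\<Union>j. F (1 / real (Suc j))"
    have F1: "finite (F (1 / real (Suc j)))" "F (1 / real (Suc j)) \<subseteq> K n"
      "K n \<subseteq> (\<Union>x\<in>F (1 / real (Suc j)). mball x (1 / real (Suc j)))" for j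
      using F[of "1 / real (Suc j)"] by auto
    have "countable ?D" by (rule countable_UN[OF _ countable_finite[OF F1(1)]]) simp
    moreover have "?D \<subseteq> K n" using F1(2) by (intro UN_least)
    moreover have "\<exists>a\<in>?D. d a z < e" if z: "z \<in> K n" and e: "0 < e" for z e
    proof -
      obtain j where "1 / real (Suc j) < e" using e by (metis nat_approx_posE)
      moreover have "\<exists>a\<in>F (1 / real (Suc j)). d a z < 1 / real (Suc j)"
        using F1(3)[of j] z unfolding subset_iff UN_iff in_mball by blast
      ultimately show ?thesis by force
    qed
    ultimately show ?thesis by (intro exI[of _ ?D]) blast
  qed
  from choice[OF allI, OF this] obtain D where
    D': "\<forall>n. countable (D n) \<and> D n \<subseteq> K n \<and> (\<forall>z\<in>K n. \<forall>e>0. \<exists>a\<in>D n. d a z < e)"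
    by (rule exE)
  have D: "countable (D n)" "D n \<subseteq> K n" "\<And>z e. z \<in> K n \<Longrightarrow> 0 < e \<Longrightarrow> \<exists>a\<in>D n. d a z < e" for n
    using spec[OF D', of n] by blast+
  \<comment> \<open>If no such coordinate exists the choice is arbitrary and may fall outside T;
    hence the intersection with T below.\<close>
  define w where "w a b q = (SOME t. t \<in> T \<and> \<bar>a t - b t\<bar> > q)" for a b :: "'t \<Rightarrow> real" and q :: real
  let ?D = "\<Union>n. D n"
  let ?S = "(\<lambda>(a, b, q). w a b q) ` (?D \<times> ?D \<times> \<rat>) \<inter> T"
  have "countable ?S" using D(1) countable_rat
    by (intro countable_Int1 countable_image countable_SIGMA countable_UN) auto
  moreover have "z = y" if zy: "z \<in> (\<Union>n. K n)" "y \<in> (\<Union>n. K n)" and eq: "\<And>t. t \<in> ?S \<Longrightarrow> z t = y t" for z y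
  proof (rule ccontr)
    assume "z \<noteq> y"
    have M: "z \<in> M" "y \<in> M" using zy compactin_subset[OF K] by auto
    with \<open>z \<noteq> y\<close> obtain t where t: "t \<in> T" "z t \<noteq> y t" using coords_separate by blast
    define s where "s = \<bar>z t - y t\<bar>"
    have s: "0 < s" using t unfolding s_def by simp
    obtain a where a: "a \<in> ?D" "d a z < s / 8" using zy(1) D(3)[of z _ "s / 8"] s by auto blast
    obtain b where b: "b \<in> ?D" "d b y < s / 8" using zy(2) D(3)[of y _ "s / 8"] s by auto blast
    have M': "a \<in> M" "b \<in> M" using a b D(2) compactin_subset[OF K] by blast+
    \<comment> \<open>Replacing z, y by a, b changes a coordinate difference by less than s/4. At t
      this leaves more than 3s/4 > q; at the recorded coordinate a difference above q > s/2 leaves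
      more than s/4 for z and y.\<close>
    obtain q where q: "q \<in> \<rat>" "s / 2 < q" "q < 3 * s / 4"
      using Rats_dense_in_real[of "s / 2" "3 * s / 4"] s by auto
    have near: "\<bar>a u - z u\<bar> < s / 8" "\<bar>b u - y u\<bar> < s / 8" if "u \<in> T" for u
      using coord_le[OF M'(1) M(1) that] coord_le[OF M'(2) M(2) that] a b by auto
    have "\<bar>a t - b t\<bar> > q" using near[OF t(1)] q s_def by linarith
    with t(1) have w: "w a b q \<in> T" "\<bar>a (w a b q) - b (w a b q)\<bar> > q"
      unfolding w_def by (metis (mono_tags, lifting) someI_ex)+
    then have "w a b q \<in> ?S" using a(1) b(1) q(1) by force
    then show False using eq[of "w a b q"] near[OF w(1)] w(2) q by linarith
  qed
  ultimately show ?thesis by (intro exI[of _ ?S]) auto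
qed

text \<open>Take points of K that are 1/(m+1)-close to x on the first m coordinates. A cluster point
  agrees with x at each t in S, since t belongs to all but finitely many of these coordinate
  sets.\<close>

lemma compactin_coord_match:
  assumes K: "compactin mtopology K" and S: "countable S" "S \<subseteq> T"
    and x: "\<And>m e. 0 < e \<Longrightarrow> \<exists>z\<in>K. coord_dist (initial_coords S m) x z < e"
  shows "\<exists>z\<in>K. \<forall>t\<in>S. z t = x t"
proof -
  have "\<exists>z\<in>K. coord_dist (initial_coords S m) x z < 1 / real (Suc m)" for m
    by (rule x) simp
  then obtain \<sigma> where \<sigma>: "\<And>m. \<sigma> m \<in> K" "\<And>m. coord_dist (initial_coords S m) x (\<sigma> m) < 1 / real (Suc m)"
    by metis
  obtain l r where l: "l \<in> K" and r: "strict_mono r" and lim: "limitin mtopology (\<sigma> \<circ> r) l sequentially"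
    using compactinE[OF K \<sigma>(1)] .
  have "l t = x t" if t: "t \<in> S" for t
  proof (rule LIMSEQ_unique)
    show "(\<lambda>n. (\<sigma> \<circ> r) n t) \<longlonglongrightarrow> l t"
      using \<sigma>(1) compactin_subset[OF K] t S by (intro tendsto_coord[OF lim]) auto
    have "eventually (\<lambda>n. \<bar>\<sigma> n t - x t\<bar> \<le> 1 / real (Suc n)) sequentially"
      unfolding eventually_sequentially
    proof (intro exI allI impI)
      fix n assume "Suc (to_nat_on S t) \<le> n"
      then have "t \<in> initial_coords S n" using t by (simp add: initial_coords_def)
      then have "\<bar>x t - \<sigma> n t\<bar> \<le> coord_dist (initial_coords S n) x (\<sigma> n)"
        by (intro coord_dist_ge finite_initial_coords S)
      then show "\<bar>\<sigma> n t - x t\<bar> \<le> 1 / real (Suc n)" using \<sigma>(2)[of n] by linarith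
    qed
    then have "(\<lambda>n. \<sigma> n t - x t) \<longlonglongrightarrow> 0"
      by (rule Lim_null_le_inverse_Suc)
    then have "(\<lambda>n. \<sigma> n t) \<longlonglongrightarrow> x t" by (simp add: Lim_null[symmetric])
    from LIMSEQ_subseq_LIMSEQ[OF this r] show "(\<lambda>n. (\<sigma> \<circ> r) n t) \<longlonglongrightarrow> x t" by (simp add: o_def)
  qed
  with l show ?thesis by blast
qed

text \<open>An existential over K, in general uncountable, becomes countably many conditions on
  finitely many coordinates each. This is what makes \<open>matches\<close> measurable and its
  indicator a limit of Lipschitz functions.\<close>

lemma gap_eq_0_iff:
  assumes K: "compactin mtopology K" "K \<noteq> {}" and S: "countable S" "S \<subseteq> T"
  shows "(\<forall>m. gap K S m x \<le> 0) \<longleftrightarrow> (\<exists>z\<in>K. \<forall>t\<in>S. z t = x t)"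
proof
  assume g: "\<forall>m. gap K S m x \<le> 0"
  show "\<exists>z\<in>K. \<forall>t\<in>S. z t = x t"
  proof (rule compactin_coord_match[OF K(1) S])
    fix m and e :: real assume "0 < e"
    with g have "gap K S m x < e" by (metis le_less_trans)
    then show "\<exists>z\<in>K. coord_dist (initial_coords S m) x z < e"
      using inf_conv_ge[OF K(2), of e "\<lambda>_. 0" "coord_dist (initial_coords S m)" x] unfolding gap_def
      by force
  qed
next
  assume "\<exists>z\<in>K. \<forall>t\<in>S. z t = x t"
  then obtain z where z: "z \<in> K" "\<And>t. t \<in> S \<Longrightarrow> z t = x t" by blast
  have "coord_dist (initial_coords S m) x z = 0" for m
    unfolding coord_dist_def using z(2) initial_coords_subset[of S m] by (intro sum.neutral) auto
  then show "\<forall>m. gap K S m x \<le> 0" using gap_le[OF z(1)] by metis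
qed

text \<open>On a compact set the coordinates in S, being continuous and separating, induce the same
  uniformity as d. Otherwise two sequences in K would approach each other in every coordinate of S
  and stay \<eta> apart; limits of common subsequences agree on S, hence coincide.\<close>

lemma compactin_coords_uniform:
  assumes K: "compactin mtopology K" and S: "countable S" "S \<subseteq> T"
    and sep: "\<And>z y. z \<in> K \<Longrightarrow> y \<in> K \<Longrightarrow> (\<And>t. t \<in> S \<Longrightarrow> z t = y t) \<Longrightarrow> z = y" and \<eta>: "0 < \<eta>"
  shows "\<exists>m \<gamma>. 0 < \<gamma> \<and>
    (\<forall>z\<in>K. \<forall>y\<in>K. coord_dist (initial_coords S m) z y < \<gamma> \<longrightarrow> d z y < \<eta>)"
proof (rule ccontr)
  assume not: "\<not> ?thesis"
  have "\<exists>z\<in>K. \<exists>y\<in>K. coord_dist (initial_coords S m) z y < 1 / real (Suc m) \<and> \<eta> \<le> d z y" for m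
  proof -
    have "(0::real) < 1 / real (Suc m)" by simp
    with not show ?thesis unfolding not_less[symmetric] by blast
  qed
  then obtain \<sigma> \<tau> where \<sigma>\<tau>: "\<And>m. \<sigma> m \<in> K" "\<And>m. \<tau> m \<in> K"
    "\<And>m. coord_dist (initial_coords S m) (\<sigma> m) (\<tau> m) < 1 / real (Suc m)" "\<And>m. \<eta> \<le> d (\<sigma> m) (\<tau> m)"
    by metis
  obtain l r where l: "l \<in> K" and r: "strict_mono r" and lim: "limitin mtopology (\<sigma> \<circ> r) l sequentially"
    using compactinE[OF K \<sigma>\<tau>(1)] .
  obtain l' r' where l': "l' \<in> K" and r': "strict_mono r'"
    and lim': "limitin mtopology ((\<tau> \<circ> r) \<circ> r') l' sequentially"
    using compactinE[OF K, of "\<tau> \<circ> r"] \<sigma>\<tau>(2) by auto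
  have lim2: "limitin mtopology ((\<sigma> \<circ> r) \<circ> r') l sequentially"
    using limitin_subsequence[OF r' lim] .
  have KM: "K \<subseteq> M" by (rule compactin_subset[OF K])
  have mono: "strict_mono (r \<circ> r')" using r r' by (simp add: strict_mono_o)
  have "l = l'"
  proof (rule sep[OF l l'])
    fix t assume t: "t \<in> S"
    have 1: "(\<lambda>n. ((\<sigma> \<circ> r) \<circ> r') n t) \<longlonglongrightarrow> l t"
      using \<sigma>\<tau>(1) KM t S by (intro tendsto_coord[OF lim2]) auto
    have 2: "(\<lambda>n. ((\<tau> \<circ> r) \<circ> r') n t) \<longlonglongrightarrow> l' t"
      using \<sigma>\<tau>(2) KM t S by (intro tendsto_coord[OF lim']) auto
    have "eventually (\<lambda>n. \<bar>\<sigma> n t - \<tau> n t\<bar> \<le> 1 / real (Suc n)) sequentially"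
      unfolding eventually_sequentially
    proof (intro exI allI impI)
      fix n assume "Suc (to_nat_on S t) \<le> n"
      then have "t \<in> initial_coords S n" using t by (simp add: initial_coords_def)
      then have "\<bar>\<sigma> n t - \<tau> n t\<bar> \<le> coord_dist (initial_coords S n) (\<sigma> n) (\<tau> n)"
        by (intro coord_dist_ge finite_initial_coords S)
      then show "\<bar>\<sigma> n t - \<tau> n t\<bar> \<le> 1 / real (Suc n)" using \<sigma>\<tau>(3)[of n] by linarith
    qed
    then have "(\<lambda>n. \<sigma> n t - \<tau> n t) \<longlonglongrightarrow> 0"
      by (rule Lim_null_le_inverse_Suc)
    from LIMSEQ_subseq_LIMSEQ[OF this mono]
    have "(\<lambda>n. ((\<sigma> \<circ> r) \<circ> r') n t - ((\<tau> \<circ> r) \<circ> r') n t) \<longlonglongrightarrow> 0" by (simp add: o_def)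
    moreover have "(\<lambda>n. ((\<sigma> \<circ> r) \<circ> r') n t - ((\<tau> \<circ> r) \<circ> r') n t) \<longlonglongrightarrow> l t - l' t"
      using 1 2 by (rule tendsto_diff)
    ultimately have "l t - l' t = 0" by (rule LIMSEQ_unique[symmetric])
    then show "l t = l' t" by simp
  qed
  have a: "eventually (\<lambda>n. d (((\<sigma> \<circ> r) \<circ> r') n) l < \<eta> / 2) sequentially"
    and b: "eventually (\<lambda>n. d (((\<tau> \<circ> r) \<circ> r') n) l < \<eta> / 2) sequentially"
    using lim2 lim' \<eta> unfolding \<open>l = l'\<close> limitin_metric by (auto dest!: spec[of _ "\<eta> / 2"] elim: eventually_mono)
  obtain n where n: "d (((\<sigma> \<circ> r) \<circ> r') n) l < \<eta> / 2" "d (((\<tau> \<circ> r) \<circ> r') n) l < \<eta> / 2"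
    using eventually_happens[OF eventually_conj[OF a b]] by auto
  have "d (((\<sigma> \<circ> r) \<circ> r') n) (((\<tau> \<circ> r) \<circ> r') n) < \<eta>"
    using n triangle[of "((\<sigma> \<circ> r) \<circ> r') n" l "((\<tau> \<circ> r) \<circ> r') n"] \<sigma>\<tau>(1,2) l KM
    by (auto simp: commute subset_iff)
  with \<sigma>\<tau>(4) show False by (simp add: not_less[symmetric])
qed

text \<open>Only y is confined to K, while z ranges over all of M. This is what carries estimates
  from K to a neighbourhood of K, where the net takes its values.\<close>

lemma compactin_uniformly_continuous:
  assumes K: "compactin mtopology K" and h: "continuous_map mtopology euclideanreal h" and \<eta>: "0 < \<eta>"
  obtains \<delta> where "0 < \<delta>" "\<And>z y. z \<in> M \<Longrightarrow> y \<in> K \<Longrightarrow> d z y < \<delta> \<Longrightarrow> \<bar>h z - h y\<bar> < \<eta>"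
proof (rule ccontr)
  assume "\<not> thesis"
  then have "\<exists>z\<in>M. \<exists>y\<in>K. d z y < 1 / real (Suc m) \<and> \<eta> \<le> \<bar>h z - h y\<bar>" for m
    using that[of "1 / real (Suc m)"] by force
  then obtain \<sigma> \<tau> where \<sigma>\<tau>: "\<And>m. \<sigma> m \<in> M" "\<And>m. \<tau> m \<in> K"
    "\<And>m. d (\<sigma> m) (\<tau> m) < 1 / real (Suc m)" "\<And>m. \<eta> \<le> \<bar>h (\<sigma> m) - h (\<tau> m)\<bar>"
    by metis
  obtain l r where l: "l \<in> K" and r: "strict_mono r" and lim: "limitin mtopology (\<tau> \<circ> r) l sequentially"
    using compactinE[OF K \<sigma>\<tau>(2)] .
  have KM: "K \<subseteq> M" by (rule compactin_subset[OF K])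
  have "(\<lambda>m. d (\<sigma> m) (\<tau> m)) \<longlonglongrightarrow> 0"
    using \<sigma>\<tau>(3) by (intro Lim_null_le_inverse_Suc always_eventually allI) (simp add: less_imp_le del: of_nat_Suc)
  from LIMSEQ_subseq_LIMSEQ[OF this r]
  have "(\<lambda>n. d ((\<sigma> \<circ> r) n) ((\<tau> \<circ> r) n) + d ((\<tau> \<circ> r) n) l) \<longlonglongrightarrow> 0 + 0"
    using lim by (intro tendsto_add) (auto simp: o_def limitin_metric_dist_null)
  then have "(\<lambda>n. d ((\<sigma> \<circ> r) n) ((\<tau> \<circ> r) n) + d ((\<tau> \<circ> r) n) l) \<longlonglongrightarrow> 0" by simp
  moreover have "\<forall>\<^sub>F n in sequentially. norm (d ((\<sigma> \<circ> r) n) l) \<le> d ((\<sigma> \<circ> r) n) ((\<tau> \<circ> r) n) + d ((\<tau> \<circ> r) n) l"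
    using \<sigma>\<tau>(1,2) l KM by (intro always_eventually) (auto intro!: triangle)
  ultimately have "(\<lambda>n. d ((\<sigma> \<circ> r) n) l) \<longlonglongrightarrow> 0" by (rule Lim_null_comparison[rotated])
  then have lim2: "limitin mtopology (\<sigma> \<circ> r) l sequentially"
    using \<sigma>\<tau>(1) l KM by (auto simp: limitin_metric_dist_null)
  then have "(\<lambda>n. h ((\<sigma> \<circ> r) n)) \<longlonglongrightarrow> h l" "(\<lambda>n. h ((\<tau> \<circ> r) n)) \<longlonglongrightarrow> h l"
    using continuous_map_limit[OF h lim2] continuous_map_limit[OF h lim] by (simp_all add: o_def)
  then have "(\<lambda>n. \<bar>h ((\<sigma> \<circ> r) n) - h ((\<tau> \<circ> r) n)\<bar>) \<longlonglongrightarrow> \<bar>h l - h l\<bar>"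
    by (intro tendsto_rabs tendsto_diff)
  then have "\<eta> \<le> \<bar>h l - h l\<bar>" by (rule LIMSEQ_le_const) (simp add: \<sigma>\<tau>(4))
  with \<eta> show False by simp
qed

end

text \<open>The relabelling p lets a function of coordinates in T act on points with other indices,
  in particular on the sequences that represent points of a Euclidean space.\<close>

lemma continuous_map_coord_lipschitz:
  assumes g: "coord_lipschitz J C g"
  shows "continuous_map (powertop_real UNIV) euclideanreal (\<lambda>x. g (\<lambda>t. x (p t)))"
proof (rule continuous_map_real_squeeze)
  fix x
  have "continuous_map (powertop_real UNIV) euclideanreal (\<lambda>y. C * coord_dist J (\<lambda>t. y (p t)) (\<lambda>t. x (p t)))"
    unfolding coord_dist_def
  proof (intro continuous_map_real_mult_left)
    have "continuous_map (powertop_real UNIV) euclideanreal (\<lambda>y. y (p t))" for t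
      by (rule continuous_map_product_projection) simp
    then show "continuous_map (powertop_real UNIV) euclideanreal (\<lambda>y. \<Sum>t\<in>J. \<bar>y (p t) - x (p t)\<bar>)"
      \<comment> \<open>For infinite J the sum is 0 by convention, so the map is constant.\<close>
      by (cases "finite J") (auto intro!: continuous_map_sum continuous_map_real_abs continuous_map_diff)
  qed
  then show "\<exists>c. continuous_map (powertop_real UNIV) euclideanreal c \<and> c x = 0 \<and>
      (\<forall>y\<in>topspace (powertop_real UNIV). \<bar>g (\<lambda>t. y (p t)) - g (\<lambda>t. x (p t))\<bar> \<le> c y)"
    using coord_lipschitzD[OF g]
    by (intro exI[of _ "\<lambda>y. C * coord_dist J (\<lambda>t. y (p t)) (\<lambda>t. x (p t))"]) simp
qed

text \<open>Numbering J factors the map through sequences of reals, a countable product whose Borel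
  sets are generated by the coordinates; on it g is continuous.\<close>

lemma measurable_coord_lipschitz:
  assumes g: "coord_lipschitz J C g" and J: "finite J"
    and Y: "\<And>t. t \<in> J \<Longrightarrow> Y t \<in> borel_measurable Q"
  shows "(\<lambda>v. g (\<lambda>t. Y t v)) \<in> borel_measurable Q"
proof -
  obtain q where q: "bij_betw q {0..<card J} J" using ex_bij_betw_nat_finite[OF J] by blast
  define p where "p = inv_into {0..<card J} q"
  have p: "p t < card J" "q (p t) = t" if "t \<in> J" for t
    using q that bij_betw_inv_into_right[OF q that] inv_into_into[of t q "{0..<card J}"]
    unfolding p_def bij_betw_def by auto
  let ?h = "\<lambda>x. g (\<lambda>t. x (p t))" and ?V = "\<lambda>v i. if i < card J then Y (q i) v else 0"
  have "continuous_on UNIV ?h"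
    using continuous_map_coord_lipschitz[OF g, of p] by (simp add: euclidean_product_topology)
  then have "?h \<in> borel_measurable borel" by (rule borel_measurable_continuous_onI)
  moreover have "?V \<in> borel_measurable Q"
  proof (rule measurable_coordinatewise_then_product)
    fix i
    show "(\<lambda>v. ?V v i) \<in> borel_measurable Q"
    proof (cases "i < card J")
      case True
      then have "q i \<in> J" using q by (auto simp: bij_betw_def)
      with True Y show ?thesis by simp
    qed simp
  qed
  ultimately have "(\<lambda>v. ?h (?V v)) \<in> borel_measurable Q" by (rule measurable_compose[rotated])
  moreover have "?h (?V v) = g (\<lambda>t. Y t v)" for v
    by (rule coord_lipschitz_cong[OF g]) (simp add: p)
  ultimately show ?thesis by simp
qed

subsection \<open>Nets with values in a metric space of functions\<close>

locale function_net = function_metric M d T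
  for M :: "('t \<Rightarrow> real) set" and d T +
  fixes I :: "'i set" and F :: "'i filter" and P :: "'i \<Rightarrow> 'w measure" and X :: "'i \<Rightarrow> 'w \<Rightarrow> 't \<Rightarrow> real"
  assumes eventually_I: "eventually (\<lambda>\<alpha>. \<alpha> \<in> I) F" and F_nontrivial: "F \<noteq> bot"
    and prob_P: "\<alpha> \<in> I \<Longrightarrow> prob_space (P \<alpha>)"
    and X_mem: "\<alpha> \<in> I \<Longrightarrow> \<omega> \<in> space (P \<alpha>) \<Longrightarrow> X \<alpha> \<omega> \<in> M"
begin

definition oexp :: "'i \<Rightarrow> (('t \<Rightarrow> real) \<Rightarrow> real) \<Rightarrow> real" where
  "oexp \<alpha> f = real_of_ereal (outer_expectation (P \<alpha>) (\<lambda>\<omega>. f (X \<alpha> \<omega>)))"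

text \<open>The condition of asymptotic tightness for one K, with the lower limit unfolded; see
  \<open>asymp_tight_iff\<close>.\<close>

definition nearly_in :: "('t \<Rightarrow> real) set \<Rightarrow> real \<Rightarrow> bool" where
  "nearly_in K \<epsilon> \<longleftrightarrow> (\<forall>\<delta>>0. \<forall>e>0. eventually (\<lambda>\<alpha>.
     1 - \<epsilon> - e < inner_prob (P \<alpha>) {\<omega> \<in> space (P \<alpha>). \<exists>y\<in>K. d (X \<alpha> \<omega>) y < \<delta>}) F)"

lemma eventually_ereal_oexp:
  assumes "\<And>z. z \<in> M \<Longrightarrow> \<bar>f z\<bar> \<le> b"
  shows "eventually (\<lambda>\<alpha>. outer_expectation (P \<alpha>) (\<lambda>\<omega>. f (X \<alpha> \<omega>)) = ereal (oexp \<alpha> f)) F"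
  using eventually_I
proof eventually_elim
  fix \<alpha> assume \<alpha>: "\<alpha> \<in> I"
  interpret prob_space "P \<alpha>" using \<alpha> by (rule prob_P)
  show "outer_expectation (P \<alpha>) (\<lambda>\<omega>. f (X \<alpha> \<omega>)) = ereal (oexp \<alpha> f)"
    unfolding oexp_def using assms X_mem[OF \<alpha>] by (intro outer_expectation_ereal[of _ b]) auto
qed

lemma tendsto_oexp_iff:
  assumes "\<And>z. z \<in> M \<Longrightarrow> \<bar>f z\<bar> \<le> b"
  shows "((\<lambda>\<alpha>. outer_expectation (P \<alpha>) (\<lambda>\<omega>. f (X \<alpha> \<omega>))) \<longlongrightarrow> ereal l) F
    \<longleftrightarrow> ((\<lambda>\<alpha>. oexp \<alpha> f) \<longlongrightarrow> l) F"
  using tendsto_cong[OF eventually_ereal_oexp[of f b]] assms by auto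

lemma nearly_in_nonempty:
  assumes "nearly_in K \<epsilon>" "\<epsilon> < 1"
  shows "K \<noteq> {}"
proof
  assume "K = {}"
  \<comment> \<open>The slack 1 - \<epsilon> turns the lower bound into 0, which the inner
    probability of the empty set does not exceed.\<close>
  have "eventually (\<lambda>\<alpha>. 1 - \<epsilon> - (1 - \<epsilon>) < inner_prob (P \<alpha>) {\<omega> \<in> space (P \<alpha>). \<exists>y\<in>K. d (X \<alpha> \<omega>) y < 1}) F"
    using assms(1)[unfolded nearly_in_def, rule_format, of 1 "1 - \<epsilon>"] assms(2) by simp
  moreover have "inner_prob (P \<alpha>) {} = 0" for \<alpha>
    unfolding inner_prob_def by (simp add: Collect_conv_if)
  ultimately show False
    using F_nontrivial unfolding \<open>K = {}\<close> by (auto simp: eventually_False)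
qed

lemma eventually_oexp_le_add:
  assumes K: "nearly_in K \<epsilon>" and b: "0 < b"
    and f: "\<And>z. z \<in> M \<Longrightarrow> \<bar>f z\<bar> \<le> b" and g: "\<And>z. z \<in> M \<Longrightarrow> \<bar>g z\<bar> \<le> b"
    and \<delta>: "0 < \<delta>" and fg: "\<And>z y. z \<in> M \<Longrightarrow> y \<in> K \<Longrightarrow> d z y < \<delta> \<Longrightarrow> f z \<le> g z + \<eta>"
    and \<eta>: "0 \<le> \<eta>" and e: "0 < e"
  shows "eventually (\<lambda>\<alpha>. oexp \<alpha> f \<le> oexp \<alpha> g + \<eta> + 2 * b * (\<epsilon> + e)) F"
proof -
  have "eventually (\<lambda>\<alpha>. 1 - \<epsilon> - e < inner_prob (P \<alpha>) {\<omega> \<in> space (P \<alpha>). \<exists>y\<in>K. d (X \<alpha> \<omega>) y < \<delta>}) F"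
    using K \<delta> e unfolding nearly_in_def by blast
  then show ?thesis using eventually_I
  proof eventually_elim
    fix \<alpha> assume \<alpha>: "\<alpha> \<in> I"
      and p: "1 - \<epsilon> - e < inner_prob (P \<alpha>) {\<omega> \<in> space (P \<alpha>). \<exists>y\<in>K. d (X \<alpha> \<omega>) y < \<delta>}"
        (is "_ < inner_prob _ ?B")
    interpret prob_space "P \<alpha>" using \<alpha> by (rule prob_P)
    have "oexp \<alpha> f \<le> oexp \<alpha> g + \<eta> + 2 * b * (1 - inner_prob (P \<alpha>) ?B)"
      unfolding oexp_def
      using b f g fg \<eta> X_mem[OF \<alpha>] by (intro outer_expectation_le_add) auto
    also have "\<dots> \<le> oexp \<alpha> g + \<eta> + 2 * b * (\<epsilon> + e)" using p b by simp
    finally show "oexp \<alpha> f \<le> oexp \<alpha> g + \<eta> + 2 * b * (\<epsilon> + e)" .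
  qed
qed

lemma coord_lipschitz_uniform:
  assumes g: "coord_lipschitz J C g" and J: "J \<subseteq> T" and \<eta>: "0 < \<eta>"
  obtains \<delta> where "0 < \<delta>" "\<And>z y. z \<in> M \<Longrightarrow> y \<in> M \<Longrightarrow> d z y < \<delta> \<Longrightarrow> \<bar>g z - g y\<bar> < \<eta>"
proof
  \<comment> \<open>On M, g is Lipschitz for d with this constant; the 1 added below covers the case
    that it vanishes.\<close>
  let ?c = "C * real (card J)"
  have c: "0 \<le> ?c" using g unfolding coord_lipschitz_def by simp
  then show "0 < \<eta> / (?c + 1)" using \<eta> by (intro divide_pos_pos) linarith+
  fix z y assume M: "z \<in> M" "y \<in> M" and d: "d z y < \<eta> / (?c + 1)"
  have "\<bar>g z - g y\<bar> \<le> C * coord_dist J z y" by (rule coord_lipschitzD[OF g])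
  also have "\<dots> \<le> C * (real (card J) * d z y)"
    using g coord_dist_le[OF J M] unfolding coord_lipschitz_def by (intro mult_left_mono) auto
  also have "\<dots> \<le> (?c + 1) * d z y" by (simp add: distrib_right)
  also have "\<dots> < \<eta>" using d c by (simp add: pos_less_divide_eq mult.commute)
  finally show "\<bar>g z - g y\<bar> < \<eta>" .
qed

end

subsection \<open>The version of the limit process\<close>

text \<open>Convergence of the marginals is recorded only through bounded Lipschitz functions of
  finitely many coordinates, evaluated at whole paths; no numbering of the coordinates is
  involved.\<close>

locale fdd_limit = function_net M d T I F P X + prob_space Q
  for M :: "('t \<Rightarrow> real) set" and d T and I :: "'i set" and F and P :: "'i \<Rightarrow> 'w measure" and X
    and Q :: "'v measure" +
  fixes Y :: "'t \<Rightarrow> 'v \<Rightarrow> real"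
  assumes Y_measurable: "t \<in> T \<Longrightarrow> Y t \<in> borel_measurable Q"
    and fdd: "finite J \<Longrightarrow> J \<subseteq> T \<Longrightarrow> coord_lipschitz J C g \<Longrightarrow> (\<And>z. \<bar>g z\<bar> \<le> b) \<Longrightarrow>
      ((\<lambda>\<alpha>. outer_expectation (P \<alpha>) (\<lambda>\<omega>. g (X \<alpha> \<omega>))) \<longlongrightarrow> ereal (\<integral>v. g (\<lambda>t. Y t v) \<partial>Q)) F"
begin

lemma fdd_oexp:
  assumes "finite J" "J \<subseteq> T" "coord_lipschitz J C g" "\<And>z. \<bar>g z\<bar> \<le> b"
  shows "((\<lambda>\<alpha>. oexp \<alpha> g) \<longlongrightarrow> (\<integral>v. g (\<lambda>t. Y t v) \<partial>Q)) F"
  using tendsto_oexp_iff[of g b] fdd[of J C g b] assms by auto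

lemma random_variable_coord_lipschitz:
  assumes "finite J" "J \<subseteq> T" "coord_lipschitz J C g"
  shows "(\<lambda>v. g (\<lambda>t. Y t v)) \<in> borel_measurable Q"
  by (rule measurable_coord_lipschitz[OF assms(3,1)]) (use assms(2) Y_measurable in blast)

text \<open>Near K the function g is almost 1, and the net is mostly near K, so g is compared with
  the constant 1 before passing to the limit. The three parts e/3, one from g and two from the slack
  with b = 1, add up to e.\<close>

lemma expectation_ge:
  assumes K: "K \<subseteq> M" "nearly_in K \<epsilon>" and J: "finite J" "J \<subseteq> T" and g: "coord_lipschitz J C g"
    and g01: "\<And>z. 0 \<le> g z" "\<And>z. g z \<le> 1" and gK: "\<And>z. z \<in> K \<Longrightarrow> g z = 1"
  shows "1 - 2 * \<epsilon> \<le> (\<integral>v. g (\<lambda>t. Y t v) \<partial>Q)"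
proof (rule field_le_epsilon)
  fix e :: real assume e: "0 < e"
  obtain \<delta> where \<delta>: "0 < \<delta>" "\<And>z y. z \<in> M \<Longrightarrow> y \<in> M \<Longrightarrow> d z y < \<delta> \<Longrightarrow> \<bar>g z - g y\<bar> < e / 3"
    using coord_lipschitz_uniform[OF g J(2), of "e / 3"] e by auto
  have gb: "\<bar>g z\<bar> \<le> 1" for z using g01[of z] by simp
  have near: "1 \<le> g z + e / 3" if "z \<in> M" "y \<in> K" "d z y < \<delta>" for z y
    using \<delta>(2)[OF that(1) subsetD[OF K(1) that(2)] that(3)] gK[OF that(2)] by linarith
  have ev: "eventually (\<lambda>\<alpha>. oexp \<alpha> (\<lambda>_. 1) \<le> oexp \<alpha> g + e / 3 + 2 * 1 * (\<epsilon> + e / 3)) F"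
    using K(2) \<delta>(1) e gb near by (intro eventually_oexp_le_add[where \<delta> = \<delta>]) auto
  have "((\<lambda>\<alpha>. oexp \<alpha> (\<lambda>_. 1)) \<longlongrightarrow> (\<integral>v. 1 \<partial>Q)) F"
    by (rule fdd_oexp[of "{}" 0 _ 1]) (auto simp: coord_lipschitz_def)
  moreover have "((\<lambda>\<alpha>. oexp \<alpha> g + e / 3 + 2 * 1 * (\<epsilon> + e / 3))
      \<longlongrightarrow> (\<integral>v. g (\<lambda>t. Y t v) \<partial>Q) + e / 3 + 2 * 1 * (\<epsilon> + e / 3)) F"
    by (intro tendsto_add tendsto_const fdd_oexp[OF J g gb])
  ultimately have "(\<integral>v. 1 \<partial>Q) \<le> (\<integral>v. g (\<lambda>t. Y t v) \<partial>Q) + e / 3 + 2 * 1 * (\<epsilon> + e / 3)"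
    using F_nontrivial ev by (intro tendsto_le[of F])
  then show "1 - 2 * \<epsilon> \<le> (\<integral>v. g (\<lambda>t. Y t v) \<partial>Q) + e" by (simp add: prob_space)
qed

definition matches :: "('t \<Rightarrow> real) set \<Rightarrow> 't set \<Rightarrow> 'v set" where
  "matches K S = {v \<in> space Q. \<exists>z\<in>K. \<forall>t\<in>S. z t = Y t v}"

lemma matches_events:
  assumes K: "compactin mtopology K" and S: "countable S" "S \<subseteq> T"
  shows "matches K S \<in> events"
proof (cases "K = {}")
  case True
  then show ?thesis by (simp add: matches_def)
next
  case False
  have [measurable]: "(\<lambda>v. gap K S m (\<lambda>t. Y t v)) \<in> borel_measurable Q" for m
    using S initial_coords_subset[of S m]
    by (intro random_variable_coord_lipschitz[OF finite_initial_coords _ coord_lipschitz_gap[OF False]]) auto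
  have "matches K S = {v \<in> space Q. \<forall>m. gap K S m (\<lambda>t. Y t v) \<le> 0}"
    unfolding matches_def gap_eq_0_iff[OF K False S] ..
  also have "\<dots> \<in> events" by measurable
  finally show ?thesis .
qed

text \<open>With m both the steepness of the bump and the number of coordinates grow, so the bumps
  decrease pointwise to the indicator of the event. Each is 1 on K, hence has expectation at least 1
  - 2\<epsilon>.\<close>

lemma prob_matches:
  assumes K: "compactin mtopology K" "nearly_in K \<epsilon>" "\<epsilon> < 1" and S: "countable S" "S \<subseteq> T"
  shows "1 - 2 * \<epsilon> \<le> prob (matches K S)"
proof -
  let ?f = "\<lambda>m z. max 0 (1 - real m * gap K S m z)"
  have ne: "K \<noteq> {}" using nearly_in_nonempty K by blast
  have lip: "coord_lipschitz (initial_coords S m) (real m * 1) (?f m)" for m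
  proof (rule coord_lipschitz_compose[OF coord_lipschitz_gap[OF ne], where \<phi> = "\<lambda>x. max 0 (1 - real m * x)"])
    fix x y :: real
    have "\<bar>max 0 (1 - real m * x) - max 0 (1 - real m * y)\<bar> \<le> \<bar>real m * x - real m * y\<bar>" by linarith
    also have "\<dots> = real m * \<bar>x - y\<bar>" by (simp add: abs_mult flip: right_diff_distrib)
    finally show "\<bar>max 0 (1 - real m * x) - max 0 (1 - real m * y)\<bar> \<le> real m * \<bar>x - y\<bar>" .
  qed simp
  have J: "finite (initial_coords S m)" "initial_coords S m \<subseteq> T" for m
    using S initial_coords_subset[of S m] finite_initial_coords by auto
  have le: "1 - 2 * \<epsilon> \<le> (\<integral>v. ?f m (\<lambda>t. Y t v) \<partial>Q)" for m
  proof (rule expectation_ge[OF compactin_subset[OF K(1)] K(2) J lip])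
    show "?f m z \<le> 1" for z using gap_nonneg[OF ne] by simp
    show "?f m z = 1" if "z \<in> K" for z
      using gap_le[OF that, of S m z] gap_nonneg[OF ne, of S m z] by simp
  qed simp
  have "(\<lambda>m. \<integral>v. ?f m (\<lambda>t. Y t v) \<partial>Q) \<longlonglongrightarrow> (\<integral>v. indicator (matches K S) v \<partial>Q)"
  proof (rule integral_dominated_convergence[where w = "\<lambda>_. 1"])
    show "(indicator (matches K S) :: _ \<Rightarrow> real) \<in> borel_measurable Q"
      using matches_events[OF K(1) S] by simp
    show "(\<lambda>v. ?f m (\<lambda>t. Y t v)) \<in> borel_measurable Q" for m
      by (rule random_variable_coord_lipschitz[OF J lip])
    show "AE v in Q. (\<lambda>m. ?f m (\<lambda>t. Y t v)) \<longlonglongrightarrow> indicator (matches K S) v"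
    proof (rule AE_I2)
      fix v assume v: "v \<in> space Q"
      let ?x = "\<lambda>t. Y t v"
      show "(\<lambda>m. ?f m ?x) \<longlonglongrightarrow> indicator (matches K S) v"
      proof (cases "v \<in> matches K S")
        case True
        then have "\<exists>z\<in>K. \<forall>t\<in>S. z t = Y t v" unfolding matches_def by simp
        then have "gap K S m ?x = 0" for m
          using gap_eq_0_iff[OF K(1) ne S, of ?x] gap_nonneg[OF ne, of S m ?x] by (auto intro: antisym)
        with True show ?thesis by simp
      next
        case False
        then have "\<not> (\<exists>z\<in>K. \<forall>t\<in>S. z t = Y t v)" using v unfolding matches_def by blast
        then obtain m0 where m0: "0 < gap K S m0 ?x"
          using gap_eq_0_iff[OF K(1) ne S, of ?x] by (meson not_le)
        obtain n0 where n0: "1 / gap K S m0 ?x < real n0" using reals_Archimedean2 by blast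
        have "?f m ?x = 0" if m: "max m0 n0 \<le> m" for m
        proof -
          have "1 \<le> real n0 * gap K S m0 ?x" using n0 m0 by (simp add: pos_divide_less_eq)
          also have "\<dots> \<le> real m * gap K S m ?x"
            using m m0 gap_mono[OF ne S(1), of m0 m ?x] by (intro mult_mono) auto
          finally show ?thesis by simp
        qed
        then have "eventually (\<lambda>m. ?f m ?x = 0) sequentially"
          unfolding eventually_sequentially by blast
        then show ?thesis using False by (simp add: tendsto_eventually)
      qed
    qed
    show "AE v in Q. norm (?f m (\<lambda>t. Y t v)) \<le> 1" for m
      using gap_nonneg[OF ne] by (intro AE_I2) simp
  qed simp
  then have "1 - 2 * \<epsilon> \<le> (\<integral>v. indicator (matches K S) v \<partial>Q)"
    using le by (intro LIMSEQ_le_const) auto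
  then show ?thesis using matches_events[OF K(1) S] by simp
qed

theorem version_weak_limit:
  assumes tight: "\<And>\<epsilon>. 0 < \<epsilon> \<Longrightarrow> \<exists>K. compactin mtopology K \<and> nearly_in K \<epsilon>"
  obtains Y' where "\<And>v. v \<in> space Q \<Longrightarrow> Y' v \<in> M" "\<And>t. t \<in> T \<Longrightarrow> AE v in Q. Y' v t = Y t v"
    "net_weak_conv F mtopology P X Q Y'" "tight_map mtopology Q Y'"
proof -
  \<comment> \<open>The shift by 2 keeps all values below 1, including n = 0, so that every
    \<open>K n\<close> is nonempty.\<close>
  define \<epsilon> where "\<epsilon> n = 1 / (real n + 2)" for n
  have \<epsilon>: "0 < \<epsilon> n" "\<epsilon> n < 1" for n unfolding \<epsilon>_def by auto
  have small: "\<exists>n. \<epsilon> n < e" if "0 < e" for e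
  proof -
    obtain n where "1 / e < real n" using reals_Archimedean2 by blast
    then have "\<epsilon> n < e" unfolding \<epsilon>_def using that by (simp add: field_simps)
    then show ?thesis ..
  qed
  from choice[OF allI, OF tight[OF \<epsilon>(1)]]
  obtain K where K': "\<forall>n. compactin mtopology (K n) \<and> nearly_in (K n) (\<epsilon> n)" by (rule exE)
  have K: "compactin mtopology (K n)" and near: "nearly_in (K n) (\<epsilon> n)" for n
    using K' by simp_all
  note KM = compactin_subset[OF K]
  obtain S where S: "countable S" "S \<subseteq> T"
    and sep: "\<forall>z\<in>\<Union>(range K). \<forall>y\<in>\<Union>(range K). (\<forall>t\<in>S. z t = y t) \<longrightarrow> z = y"
    using countable_separating_coords[of K, OF K] by (elim exE conjE)
  obtain z0 where z0: "z0 \<in> K 0" using nearly_in_nonempty[OF near \<epsilon>(2)] by blast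
  define A where "A = (\<Union>n. matches (K n) S)"
  \<comment> \<open>Off A, which will turn out to be a null set, the constant value
    \<open>z0\<close> keeps the paths in M and the map measurable.\<close>
  define Y' where "Y' v = (if v \<in> A then THE z. z \<in> (\<Union>n. K n) \<and> (\<forall>t\<in>S. z t = Y t v) else z0)" for v
  have Y'_eq: "Y' v = z" if "v \<in> space Q" "z \<in> K n" "\<forall>t\<in>S. z t = Y t v" for v z n
  proof -
    have "v \<in> A" using that unfolding A_def matches_def by blast
    moreover have "(THE z. z \<in> (\<Union>n. K n) \<and> (\<forall>t\<in>S. z t = Y t v)) = z"
    proof (rule the_equality)
      show "z \<in> (\<Union>n. K n) \<and> (\<forall>t\<in>S. z t = Y t v)" using that by blast
      show "y = z" if "y \<in> (\<Union>n. K n) \<and> (\<forall>t\<in>S. y t = Y t v)" for y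
        using that \<open>z \<in> K n\<close> \<open>\<forall>t\<in>S. z t = Y t v\<close> by (intro sep[rule_format]) auto
    qed
    ultimately show ?thesis unfolding Y'_def by simp
  qed
  have Y'_A: "\<exists>n. Y' v \<in> K n" "\<forall>t\<in>S. Y' v t = Y t v" if v: "v \<in> A" for v
  proof -
    obtain n z where "v \<in> space Q" "z \<in> K n" "\<forall>t\<in>S. z t = Y t v"
      using v unfolding A_def matches_def by blast
    with Y'_eq[OF this] show "\<exists>n. Y' v \<in> K n" "\<forall>t\<in>S. Y' v t = Y t v" by auto
  qed
  have A: "A \<in> events" unfolding A_def using matches_events[OF K S] by blast
  have Y'_M: "Y' v \<in> M" for v
    using Y'_A(1)[of v] KM z0 by (cases "v \<in> A") (auto simp: Y'_def)
  \<comment> \<open>S' is left free because it is used both for S and for S with one more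
    coordinate; the same \<open>K n\<close> serve for all S'.\<close>
  have full: "AE v in Q. v \<in> (\<Union>n. matches (K n) S')" if S': "countable S'" "S' \<subseteq> T" for S'
  proof -
    let ?B = "\<Union>n. matches (K n) S'"
    have B: "?B \<in> events" using matches_events[OF K S'] by blast
    have "1 \<le> prob ?B"
    proof (rule field_le_epsilon)
      fix e :: real assume "0 < e"
      then obtain n where n: "\<epsilon> n < e / 2" using small[of "e / 2"] by auto
      have "1 - 2 * \<epsilon> n \<le> prob (matches (K n) S')" by (rule prob_matches[OF K near \<epsilon>(2) S'])
      also have "\<dots> \<le> prob ?B" using B by (intro finite_measure_mono) auto
      finally show "1 \<le> prob ?B + e" using n by simp
    qed
    then have "prob ?B = 1" using prob_le_1[of ?B] by linarith
    then show ?thesis using B by (simp add: prob_eq_1)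
  qed
  have ae: "AE v in Q. Y' v t = Y t v" if t: "t \<in> T" for t
  proof -
    \<comment> \<open>A point that matches on the larger set also matches on S, so by
      \<open>Y'_eq\<close> it is \<open>Y' v\<close>.\<close>
    have "AE v in Q. v \<in> (\<Union>n. matches (K n) (insert t S))" using S t by (intro full) auto
    then show ?thesis
    proof eventually_elim
      fix v assume "v \<in> (\<Union>n. matches (K n) (insert t S))"
      then obtain n z where "v \<in> space Q" "z \<in> K n" "\<forall>s\<in>insert t S. z s = Y s v"
        unfolding matches_def by blast
      with Y'_eq[of v z n] show "Y' v t = Y t v" by simp
    qed
  qed
  \<comment> \<open>On A, the value lies in C iff some compact \<open>K n \<inter> C\<close> is
    matched on S, which is an event by \<open>matches_events\<close>.\<close>
  have preimage_closed: "{v \<in> space Q. Y' v \<in> C} \<in> events" if C: "closedin mtopology C" for C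
  proof -
    have "{v \<in> space Q. Y' v \<in> C}
      = (\<Union>n. matches (K n \<inter> C) S) \<union> (if z0 \<in> C then space Q - A else {})"
    proof (intro set_eqI iffI)
      fix v assume v: "v \<in> {v \<in> space Q. Y' v \<in> C}"
      show "v \<in> (\<Union>n. matches (K n \<inter> C) S) \<union> (if z0 \<in> C then space Q - A else {})"
      proof (cases "v \<in> A")
        case True
        then obtain n where "Y' v \<in> K n" using Y'_A by blast
        then have "v \<in> matches (K n \<inter> C) S" using v Y'_A(2)[OF True] unfolding matches_def by blast
        then show ?thesis by blast
      next
        case False
        with v show ?thesis by (auto simp: Y'_def)
      qed
    next
      fix v assume "v \<in> (\<Union>n. matches (K n \<inter> C) S) \<union> (if z0 \<in> C then space Q - A else {})"
      then consider n z where "v \<in> space Q" "z \<in> K n" "z \<in> C" "\<forall>t\<in>S. z t = Y t v"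
        | "z0 \<in> C" "v \<in> space Q - A"
        unfolding matches_def by (auto split: if_splits)
      then show "v \<in> {v \<in> space Q. Y' v \<in> C}"
        by cases (auto simp: Y'_eq, simp add: Y'_def)
    qed
    moreover have "matches (K n \<inter> C) S \<in> events" for n
      using compact_Int_closedin[OF K C] S by (intro matches_events)
    ultimately show ?thesis using A by auto
  qed
  have Y'_measurable: "Y' \<in> measurable Q (borel_of mtopology)"
    unfolding borel_of_def
  proof (rule measurable_sigma_sets)
    show "sets (sigma (topspace mtopology) {U. openin mtopology U}) = sigma_sets (topspace mtopology) {U. openin mtopology U}"
      using sets_borel_of[of mtopology] unfolding borel_of_def .
    show "{U. openin mtopology U} \<subseteq> Pow (topspace mtopology)"
      using openin_subset by blast
    show "Y' \<in> space Q \<rightarrow> topspace mtopology" using Y'_M by simp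
    fix U assume "U \<in> {U. openin mtopology U}"
    then have "closedin mtopology (M - U)" by (metis closedin_diff closedin_topspace mem_Collect_eq topspace_mtopology)
    from preimage_closed[OF this] have "space Q - {v \<in> space Q. Y' v \<in> M - U} \<in> events" by blast
    also have "space Q - {v \<in> space Q. Y' v \<in> M - U} = Y' -` U \<inter> space Q" using Y'_M by auto
    finally show "Y' -` U \<inter> space Q \<in> events" .
  qed
  have prob_K: "1 - 2 * \<epsilon> n \<le> prob {v \<in> space Q. Y' v \<in> K n}" for n
  proof -
    have "1 - 2 * \<epsilon> n \<le> prob (matches (K n) S)" by (rule prob_matches[OF K near \<epsilon>(2) S])
    also have "\<dots> \<le> prob {v \<in> space Q. Y' v \<in> K n}"
    proof (rule finite_measure_mono)
      show "matches (K n) S \<subseteq> {v \<in> space Q. Y' v \<in> K n}" unfolding matches_def using Y'_eq by auto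
      show "{v \<in> space Q. Y' v \<in> K n} \<in> events"
        using K Hausdorff_space_mtopology by (intro preimage_closed compactin_imp_closedin)
    qed
    finally show ?thesis .
  qed
  have "net_weak_conv F mtopology P X Q Y'"
    unfolding net_weak_conv_def
  proof (intro conjI allI impI)
    show "prob_space Q" by (rule prob_space_axioms)
    fix h assume h: "continuous_map mtopology euclideanreal h" and "bounded (h ` topspace mtopology)"
    then obtain b' where "\<And>z. z \<in> M \<Longrightarrow> \<bar>h z\<bar> \<le> b'" unfolding bounded_iff by auto
    then obtain b where b: "0 < b" and hb: "\<And>z. z \<in> M \<Longrightarrow> \<bar>h z\<bar> \<le> b"
      by (metis abs_ge_zero le_less_trans less_add_one less_imp_le order_trans)
    have hY[measurable]: "(\<lambda>v. h (Y' v)) \<in> borel_measurable Q"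
      using measurable_compose[OF Y'_measurable continuous_map_borel_of[OF h]] .
    have "((\<lambda>\<alpha>. oexp \<alpha> h) \<longlongrightarrow> (\<integral>v. h (Y' v) \<partial>Q)) F"
    proof (rule tendstoI)
      fix e :: real assume "0 < e"
      \<comment> \<open>The errors are 3\<eta> for replacing h by g near \<open>K n\<close>, less
        than 4\<eta> away from it, less than \<eta> for the limit of g, and 5\<eta> for returning
        from g to h under Q: 13\<eta> in all.\<close>
      define \<eta> where "\<eta> = e / 14"
      have \<eta>: "0 < \<eta>" using \<open>0 < e\<close> unfolding \<eta>_def by simp
      obtain n where n: "\<epsilon> n < \<eta> / b" using small[of "\<eta> / b"] \<eta> b by auto
      then have b\<epsilon>: "b * \<epsilon> n < \<eta>" using b by (simp add: pos_less_divide_eq mult.commute)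
      obtain \<delta>1 where \<delta>1: "0 < \<delta>1"
        "\<And>z y. z \<in> M \<Longrightarrow> y \<in> K n \<Longrightarrow> d z y < \<delta>1 \<Longrightarrow> \<bar>h z - h y\<bar> < \<eta>"
        using compactin_uniformly_continuous[OF K h \<eta>, of n] by blast
      have "z = y" if "z \<in> K n" "y \<in> K n" "\<And>t. t \<in> S \<Longrightarrow> z t = y t" for z y
        using that by (intro sep[rule_format]) auto
      \<comment> \<open>The modulus \<open>\<delta>1\<close> of h is translated into closeness in
        finitely many coordinates, the form in which the McShane extension needs it.\<close>
      from compactin_coords_uniform[OF K S this \<delta>1(1)]
      obtain m \<gamma> where \<gamma>: "0 < \<gamma>"
        "\<forall>z\<in>K n. \<forall>y\<in>K n. coord_dist (initial_coords S m) z y < \<gamma> \<longrightarrow> d z y < \<delta>1"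
        by blast
      let ?J = "initial_coords S m"
      have J: "finite ?J" "?J \<subseteq> T" using S initial_coords_subset[of S m] finite_initial_coords by auto
      obtain g where g: "coord_lipschitz ?J (2 * b / \<gamma>) g" "\<And>z. \<bar>g z\<bar> \<le> b"
        "\<And>z. z \<in> K n \<Longrightarrow> \<bar>g z - h z\<bar> \<le> \<eta>"
      proof (rule min_inf_conv_approx[OF nearly_in_nonempty[OF near \<epsilon>(2)] b _ \<gamma>(1)])
        show "\<bar>h y\<bar> \<le> b" if "y \<in> K n" for y using hb KM that by blast
        show "\<bar>h z - h y\<bar> \<le> \<eta>" if "z \<in> K n" "y \<in> K n" "coord_dist ?J z y < \<gamma>" for z y
          using \<delta>1(2)[of z y] \<gamma>(2)[rule_format, OF that] KM that by force
      qed (use \<eta> in auto)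
      obtain \<delta>2 where \<delta>2: "0 < \<delta>2"
        "\<And>z y. z \<in> M \<Longrightarrow> y \<in> M \<Longrightarrow> d z y < \<delta>2 \<Longrightarrow> \<bar>g z - g y\<bar> < \<eta>"
        using coord_lipschitz_uniform[OF g(1) J(2) \<eta>] by blast
      \<comment> \<open>The three errors are g from z to y, g against h at y, and h from y to
        z.\<close>
      have close: "\<bar>g z - h z\<bar> \<le> 3 * \<eta>" if "z \<in> M" "y \<in> K n" "d z y < min \<delta>1 \<delta>2" for z y
        using \<delta>1(2)[of z y] \<delta>2(2)[of z y] g(3)[of y] KM that by force
      have \<delta>: "0 < min \<delta>1 \<delta>2" using \<delta>1(1) \<delta>2(1) by simp
      have 1: "eventually (\<lambda>\<alpha>. oexp \<alpha> h \<le> oexp \<alpha> g + 3 * \<eta> + 2 * b * (\<epsilon> n + \<epsilon> n)) F"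
      proof (rule eventually_oexp_le_add[OF near b hb g(2) \<delta> _ _ \<epsilon>(1)])
        show "h z \<le> g z + 3 * \<eta>" if "z \<in> M" "y \<in> K n" "d z y < min \<delta>1 \<delta>2" for z y
          using close[OF that] by linarith
        show "0 \<le> 3 * \<eta>" using \<eta> by linarith
      qed
      have 2: "eventually (\<lambda>\<alpha>. oexp \<alpha> g \<le> oexp \<alpha> h + 3 * \<eta> + 2 * b * (\<epsilon> n + \<epsilon> n)) F"
      proof (rule eventually_oexp_le_add[OF near b g(2) hb \<delta> _ _ \<epsilon>(1)])
        show "g z \<le> h z + 3 * \<eta>" if "z \<in> M" "y \<in> K n" "d z y < min \<delta>1 \<delta>2" for z y
          using close[OF that] by linarith
        show "0 \<le> 3 * \<eta>" using \<eta> by linarith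
      qed
      have 3: "eventually (\<lambda>\<alpha>. dist (oexp \<alpha> g) (\<integral>v. g (\<lambda>t. Y t v) \<partial>Q) < \<eta>) F"
        using tendstoD[OF fdd_oexp[OF J g(1,2)] \<eta>] .
      \<comment> \<open>The integrands differ by at most \<eta> where \<open>Y'\<close> lies in
        \<open>K n\<close> and by at most 2b on the rest, which has probability at most 2
        \<open>\<epsilon> n\<close>.\<close>
      have 4: "\<bar>(\<integral>v. g (\<lambda>t. Y t v) \<partial>Q) - (\<integral>v. h (Y' v) \<partial>Q)\<bar> \<le> 5 * \<eta>"
      proof -
        have gY[measurable]: "(\<lambda>v. g (\<lambda>t. Y t v)) \<in> borel_measurable Q" by (rule random_variable_coord_lipschitz[OF J g(1)])
        let ?B = "{v \<in> space Q. Y' v \<in> K n}"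
        have B[measurable]: "?B \<in> events"
          using K Hausdorff_space_mtopology by (intro preimage_closed compactin_imp_closedin)
        have int: "integrable Q (\<lambda>v. g (\<lambda>t. Y t v))" "integrable Q (\<lambda>v. h (Y' v))"
          using g(2) hb Y'_M by (auto intro!: bounded_integrable[of _ b])
        have "\<bar>(\<integral>v. g (\<lambda>t. Y t v) \<partial>Q) - (\<integral>v. h (Y' v) \<partial>Q)\<bar> = \<bar>\<integral>v. g (\<lambda>t. Y t v) - h (Y' v) \<partial>Q\<bar>"
          using int by simp
        also have "\<dots> \<le> (\<integral>v. \<bar>g (\<lambda>t. Y t v) - h (Y' v)\<bar> \<partial>Q)" by (rule integral_abs_bound)
        also have "\<dots> \<le> (\<integral>v. \<eta> + 2 * b * (1 - indicator ?B v) \<partial>Q)"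
        proof (rule integral_mono_AE)
          show "integrable Q (\<lambda>v. \<bar>g (\<lambda>t. Y t v) - h (Y' v)\<bar>)" using int by auto
          show "integrable Q (\<lambda>v. \<eta> + 2 * b * (1 - indicator ?B v))"
            by (auto intro!: integrable_real_indicator simp: emeasure_eq_measure)
          show "AE v in Q. \<bar>g (\<lambda>t. Y t v) - h (Y' v)\<bar> \<le> \<eta> + 2 * b * (1 - indicator ?B v)"
            using full[OF S] unfolding A_def[symmetric]
          proof eventually_elim
            fix v assume v: "v \<in> A"
            \<comment> \<open>The coordinates of g lie in S, where \<open>Y' v\<close> takes the
              values of Y.\<close>
            have "g (\<lambda>t. Y t v) = g (Y' v)"
              using Y'_A(2)[OF v] initial_coords_subset[of S m] by (intro coord_lipschitz_cong[OF g(1)]) auto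
            moreover have "v \<in> space Q" using A v sets.sets_into_space by blast
            ultimately show "\<bar>g (\<lambda>t. Y t v) - h (Y' v)\<bar> \<le> \<eta> + 2 * b * (1 - indicator ?B v)"
              using g(3)[of "Y' v"] g(2)[of "Y' v"] hb[OF Y'_M, of v] \<eta> by (cases "Y' v \<in> K n") auto
          qed
        qed
        also have "\<dots> = \<eta> + 2 * b * (1 - prob ?B)" by (simp add: prob_space emeasure_eq_measure)
        also have "\<dots> \<le> \<eta> + 2 * b * (2 * \<epsilon> n)"
          using prob_K[of n] b by simp
        also have "\<dots> \<le> 5 * \<eta>" using b\<epsilon> by simp
        finally show ?thesis .
      qed
      from 1 2 3 show "eventually (\<lambda>\<alpha>. dist (oexp \<alpha> h) (\<integral>v. h (Y' v) \<partial>Q) < e) F"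
      proof eventually_elim
        case (elim \<alpha>)
        have "2 * b * (\<epsilon> n + \<epsilon> n) < 4 * \<eta>" using b\<epsilon> by simp
        moreover have "e = 14 * \<eta>" unfolding \<eta>_def by simp
        ultimately show ?case using elim 4 unfolding dist_real_def by linarith
      qed
    qed
    then show "((\<lambda>\<alpha>. outer_expectation (P \<alpha>) (\<lambda>\<omega>. h (X \<alpha> \<omega>))) \<longlongrightarrow> ereal (\<integral>v. h (Y' v) \<partial>Q)) F"
      using tendsto_oexp_iff[of h b] hb by blast
  qed (fact Y'_measurable)
  moreover have "tight_map mtopology Q Y'"
    unfolding tight_map_def
  proof (intro allI impI)
    fix e :: real assume "0 < e"
    then obtain n where "\<epsilon> n < e / 2" using small[of "e / 2"] by auto
    with prob_K[of n] K show "\<exists>K. compactin mtopology K \<and> 1 - e \<le> prob {v \<in> space Q. Y' v \<in> K}"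
      by (intro exI[of _ "K n"]) auto
  qed
  ultimately show ?thesis using that Y'_M ae by blast
qed

end

section \<open>Continuity and Borel measurability of maps between topological spaces\<close>

lemma (in Metric_space) lipschitz_imp_continuous_map:
  assumes C: "0 \<le> C" and h: "\<And>x y. x \<in> M \<Longrightarrow> y \<in> M \<Longrightarrow> \<bar>h x - h y\<bar> \<le> C * d x y"
  shows "continuous_map mtopology euclideanreal h"
  unfolding continuous_map_atin
proof
  fix x assume "x \<in> topspace mtopology"
  then have x: "x \<in> M" by simp
  have "(h \<longlongrightarrow> h x) (atin mtopology x)"
  proof (rule tendstoI)
    fix e :: real assume e: "0 < e"
    have "dist (h y) (h x) < e" if "y \<in> mball x (e / (C + 1))" for y
    proof -
      have y: "y \<in> M" "d y x < e / (C + 1)" using that by (auto simp: commute)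
      have "\<bar>h y - h x\<bar> \<le> (C + 1) * d y x"
        using h[OF y(1) x] nonneg[of y x] unfolding distrib_right by linarith
      also have "\<dots> < e" using y(2) C by (simp add: pos_less_divide_eq mult.commute)
      finally show ?thesis by (simp add: dist_real_def)
    qed
    then show "eventually (\<lambda>y. dist (h y) (h x) < e) (atin mtopology x)"
      unfolding eventually_atin using x e C
      by (intro disjI2 exI[of _ "mball x (e / (C + 1))"]) auto
  qed
  then show "limitin euclideanreal h (h x) (atin mtopology x)" by simp
qed

lemma continuous_map_measurable_borel_of:
  assumes "continuous_map S S' \<phi>"
  shows "\<phi> \<in> measurable (borel_of S) (borel_of S')"
  unfolding borel_of_def[of S']
proof (rule measurable_sigma_sets)
  show "sets (sigma (topspace S') {U. openin S' U}) = sigma_sets (topspace S') {U. openin S' U}"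
    using sets_borel_of[of S'] unfolding borel_of_def .
  show "{U. openin S' U} \<subseteq> Pow (topspace S')" using openin_subset by blast
  show "\<phi> \<in> space (borel_of S) \<rightarrow> topspace S'"
    using continuous_map_image_subset_topspace[OF assms] by auto
  fix U assume "U \<in> {U. openin S' U}"
  then have "openin S {x \<in> topspace S. \<phi> x \<in> U}"
    using openin_continuous_map_preimage[OF assms] by simp
  moreover have "\<phi> -` U \<inter> space (borel_of S) = {x \<in> topspace S. \<phi> x \<in> U}" by auto
  ultimately show "\<phi> -` U \<inter> space (borel_of S) \<in> sets (borel_of S)"
    unfolding sets_borel_of by auto
qed

lemma marginal_mem_Euclidean_space: "marginal k t z \<in> topspace (Euclidean_space k)"
  by (simp add: topspace_Euclidean_space marginal_def)

lemma coord_lipschitz_mono: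
  assumes g: "coord_lipschitz J C g" and J: "J \<subseteq> H" "finite H"
  shows "coord_lipschitz H C g"
  unfolding coord_lipschitz_def
proof (intro conjI allI)
  have C: "0 \<le> C" using g unfolding coord_lipschitz_def by simp
  show "\<bar>g z - g y\<bar> \<le> C * coord_dist H z y" for z y
    using coord_lipschitzD[OF g, of z y] mult_left_mono[OF coord_dist_mono[OF J(2,1)] C, of z y] by linarith
  show "0 \<le> C" by (rule C)
qed

subsection \<open>Kolmogorov extension of the marginal limits\<close>

text \<open>Writing the boxes with an index set \<open>j\<close> confined to \<open>{J}\<close>
  follows the shape in which \<open>sets_PiM_sigma\<close> delivers a generator.\<close>

lemma Int_stable_atMost_boxes:
  "Int_stable {{f \<in> J \<rightarrow>\<^sub>E UNIV. \<forall>i\<in>j. f i \<in> A i} |A j. j \<in> {J} \<and> A \<in> Pi j (\<lambda>_. range (\<lambda>a::real. {..a}))}"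
    (is "Int_stable ?E")
proof (rule Int_stableI)
  fix B C assume "B \<in> ?E" "C \<in> ?E"
  then obtain A A' where A: "A \<in> Pi J (\<lambda>_. range (\<lambda>a::real. {..a}))" "A' \<in> Pi J (\<lambda>_. range (\<lambda>a::real. {..a}))"
    and B: "B = {f \<in> J \<rightarrow>\<^sub>E UNIV. \<forall>i\<in>J. f i \<in> A i}" and C: "C = {f \<in> J \<rightarrow>\<^sub>E UNIV. \<forall>i\<in>J. f i \<in> A' i}"
    by blast
  have "A i \<inter> A' i \<in> range (\<lambda>a::real. {..a})" if i: "i \<in> J" for i
  proof -
    obtain a b where "A i = {..a}" "A' i = {..b}" using Pi_mem[OF A(1) i] Pi_mem[OF A(2) i] by blast
    then have "A i \<inter> A' i = {..min a b}" by auto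
    then show ?thesis by blast
  qed
  moreover have "B \<inter> C = {f \<in> J \<rightarrow>\<^sub>E UNIV. \<forall>i\<in>J. f i \<in> A i \<inter> A' i}" using B C by auto
  ultimately show "B \<inter> C \<in> ?E" by (intro CollectI exI[of _ "\<lambda>i. A i \<inter> A' i"] exI[of _ J]) auto
qed

lemma sets_PiM_atMost_boxes:
  assumes "finite J"
  shows "sets (PiM J (\<lambda>_. borel :: real measure)) =
    sigma_sets (J \<rightarrow>\<^sub>E UNIV)
      {{f \<in> J \<rightarrow>\<^sub>E UNIV. \<forall>i\<in>j. f i \<in> A i} |A j. j \<in> {J} \<and> A \<in> Pi j (\<lambda>_. range (\<lambda>a::real. {..a}))}"
proof -
  have "\<exists>S\<subseteq>range (\<lambda>a::real. {..a}). countable S \<and> UNIV = \<Union>S"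
  proof (intro exI conjI)
    show "range (\<lambda>n::nat. {..real n}) \<subseteq> range (\<lambda>a::real. {..a})" by auto
    show "countable (range (\<lambda>n::nat. {..real n}))" by simp
    show "UNIV = \<Union>(range (\<lambda>n::nat. {..real n}))" using real_arch_simple by auto
  qed
  then show ?thesis
    unfolding borel_eq_atMost
    by (subst sets_PiM_sigma[where J = "{J}"]) (auto simp: assms intro!: sets_measure_of)
qed

text \<open>Lower boxes form a generator stable under intersection, and the indicator of each is a
  pointwise limit of Lipschitz functions with values in [0, 1].\<close>

lemma measure_eqI_coord_lipschitz:
  fixes A B :: "('t \<Rightarrow> real) measure"
  assumes "prob_space A" "prob_space B" and J: "finite J"
    and sets: "sets A = sets (PiM J (\<lambda>_. borel))" "sets B = sets (PiM J (\<lambda>_. borel))"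
    and eq: "\<And>C g. coord_lipschitz J C g \<Longrightarrow> (\<And>z. \<bar>g z\<bar> \<le> 1) \<Longrightarrow> (\<integral>x. g x \<partial>A) = (\<integral>x. g x \<partial>B)"
  shows "A = B"
proof -
  let ?\<Omega> = "J \<rightarrow>\<^sub>E (UNIV :: real set)"
  let ?E = "{{f \<in> ?\<Omega>. \<forall>i\<in>j. f i \<in> A i} |A j. j \<in> {J} \<and> A \<in> Pi j (\<lambda>_. range (\<lambda>a::real. {..a}))}"
  define box where "box a = {f \<in> ?\<Omega>. \<forall>i\<in>J. f i \<le> a i}" for a :: "'t \<Rightarrow> real"
  have box: "\<exists>a. X = box a" if X: "X \<in> ?E" for X
  proof -
    from X obtain D where X: "X = {f \<in> ?\<Omega>. \<forall>i\<in>J. f i \<in> D i}" and "D \<in> Pi J (\<lambda>_. range (\<lambda>a::real. {..a}))"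
      by blast
    then have D: "\<forall>i\<in>J. \<exists>a. D i = {..a}" by blast
    obtain a where "\<forall>i\<in>J. D i = {..a i}" using bchoice[OF D] by blast
    then have "X = box a" unfolding X box_def by auto
    then show ?thesis by (intro exI)
  qed
  have box_E: "box a \<in> ?E" for a
    unfolding box_def by (intro CollectI exI[of _ "\<lambda>i. {..a i}"] exI[of _ J]) auto
  have box_sets: "box a \<in> sets (PiM J (\<lambda>_. borel))" for a
    unfolding sets_PiM_atMost_boxes[OF J] using box_E by (rule sigma_sets.Basic)
  \<comment> \<open>The sum is the l1 distance, in the coordinates J, from z to the box with corner
    a.\<close>
  define f where "f a m z = max 0 (1 - real m * (\<Sum>t\<in>J. max 0 (z t - a t)))" for a :: "'t \<Rightarrow> real" and m z
  have lip: "coord_lipschitz J (real m * 1) (f a m)" for a m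
    unfolding f_def
  proof (rule coord_lipschitz_compose[where \<phi> = "\<lambda>x. max 0 (1 - real m * x)"])
    show "coord_lipschitz J 1 (\<lambda>z. \<Sum>t\<in>J. max 0 (z t - a t))"
      unfolding coord_lipschitz_def
    proof (intro conjI allI)
      fix z y :: "'t \<Rightarrow> real"
      have "\<bar>(\<Sum>t\<in>J. max 0 (z t - a t)) - (\<Sum>t\<in>J. max 0 (y t - a t))\<bar>
        \<le> (\<Sum>t\<in>J. \<bar>max 0 (z t - a t) - max 0 (y t - a t)\<bar>)"
        unfolding sum_subtractf[symmetric] by (rule sum_abs)
      also have "\<dots> \<le> 1 * coord_dist J z y" unfolding coord_dist_def by (auto intro!: sum_mono)
      finally show "\<bar>(\<Sum>t\<in>J. max 0 (z t - a t)) - (\<Sum>t\<in>J. max 0 (y t - a t))\<bar> \<le> 1 * coord_dist J z y" .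
    qed simp
    fix x y :: real
    have "\<bar>max 0 (1 - real m * x) - max 0 (1 - real m * y)\<bar> \<le> \<bar>real m * x - real m * y\<bar>" by linarith
    also have "\<dots> = real m * \<bar>x - y\<bar>" by (simp add: abs_mult flip: right_diff_distrib)
    finally show "\<bar>max 0 (1 - real m * x) - max 0 (1 - real m * y)\<bar> \<le> real m * \<bar>x - y\<bar>" .
  qed simp
  have f01: "0 \<le> f a m z" "f a m z \<le> 1" for a m z
    unfolding f_def by (auto intro!: mult_nonneg_nonneg sum_nonneg)
  have lim: "(\<lambda>m. f a m z) \<longlonglongrightarrow> indicator (box a) z" if z: "z \<in> ?\<Omega>" for a z
  proof (cases "z \<in> box a")
    case True
    then have "(\<Sum>t\<in>J. max 0 (z t - a t)) = 0" unfolding box_def by (intro sum.neutral) auto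
    then show ?thesis using True unfolding f_def by simp
  next
    case False
    then obtain t where t: "t \<in> J" "a t < z t" using z unfolding box_def by force
    define s where "s = (\<Sum>t\<in>J. max 0 (z t - a t))"
    have "max 0 (z t - a t) \<le> s" unfolding s_def using J t by (intro member_le_sum) auto
    then have s: "0 < s" using t by linarith
    obtain n where n: "1 / s < real n" using reals_Archimedean2 by blast
    have "f a m z = 0" if "n \<le> m" for m
    proof -
      have "1 \<le> real n * s" using n s by (simp add: pos_divide_less_eq)
      also have "\<dots> \<le> real m * s" using that s by (intro mult_right_mono) auto
      finally show ?thesis unfolding f_def s_def[symmetric] by simp
    qed
    then have "eventually (\<lambda>m. f a m z = 0) sequentially"
      unfolding eventually_sequentially by blast
    then show ?thesis using False by (simp add: tendsto_eventually)
  qed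
  have conv: "(\<lambda>m. \<integral>x. f a m x \<partial>N) \<longlonglongrightarrow> measure N (box a)"
    if N: "prob_space N" "sets N = sets (PiM J (\<lambda>_. borel))" for N a
  proof -
    interpret prob_space N by (rule N(1))
    have sp: "space N = ?\<Omega>" using sets_eq_imp_space_eq[OF N(2)] by (simp add: space_PiM)
    have boxN: "box a \<in> sets N" using box_sets N(2) by simp
    have "(\<lambda>m. \<integral>x. f a m x \<partial>N) \<longlonglongrightarrow> (\<integral>x. indicator (box a) x \<partial>N)"
    proof (rule integral_dominated_convergence[where w = "\<lambda>_. 1"])
      show "(indicator (box a) :: _ \<Rightarrow> real) \<in> borel_measurable N" using boxN by simp
      show "f a m \<in> borel_measurable N" for m
      proof -
        have "(\<lambda>x. f a m (\<lambda>t. x t)) \<in> borel_measurable N"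
        proof (rule measurable_coord_lipschitz[OF lip J])
          show "(\<lambda>x. x t) \<in> borel_measurable N" if "t \<in> J" for t
            unfolding measurable_cong_sets[OF N(2) refl] using that by (rule measurable_component_singleton)
        qed
        then show ?thesis by simp
      qed
      show "AE x in N. (\<lambda>m. f a m x) \<longlonglongrightarrow> indicator (box a) x" using lim sp by (intro AE_I2) auto
      show "AE x in N. norm (f a m x) \<le> 1" for m using f01 by (intro AE_I2) auto
    qed simp
    then show ?thesis using boxN by simp
  qed
  have meas: "measure A (box a) = measure B (box a)" for a
  proof (rule LIMSEQ_unique[OF conv])
    have "(\<integral>x. f a m x \<partial>A) = (\<integral>x. f a m x \<partial>B)" for m
      using f01[of a m] by (intro eq[OF lip]) auto
    then show "(\<lambda>m. \<integral>x. f a m x \<partial>A) \<longlonglongrightarrow> measure B (box a)"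
      using conv[OF assms(2) sets(2)] by simp
  qed (use assms sets in auto)
  interpret A: prob_space A by fact
  interpret B: prob_space B by fact
  show ?thesis
  proof (rule measure_eqI_generator_eq[where \<Omega> = ?\<Omega> and E = ?E and A = "\<lambda>n. box (\<lambda>_. real n)"])
    show "Int_stable ?E" by (rule Int_stable_atMost_boxes)
    show "?E \<subseteq> Pow ?\<Omega>" by auto
    show "emeasure A X = emeasure B X" if X: "X \<in> ?E" for X
      using box[OF X] meas by (auto simp: A.emeasure_eq_measure B.emeasure_eq_measure)
    show "sets A = sigma_sets ?\<Omega> ?E" "sets B = sigma_sets ?\<Omega> ?E"
      using sets sets_PiM_atMost_boxes[OF J] by simp_all
    show "range (\<lambda>n. box (\<lambda>_. real n)) \<subseteq> ?E" using box_E by (rule image_subsetI)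
    show "(\<Union>n. box (\<lambda>_. real n)) = ?\<Omega>"
    proof (intro equalityI subsetI)
      fix z assume z: "z \<in> ?\<Omega>"
      obtain n where "(\<Sum>t\<in>J. \<bar>z t\<bar>) \<le> real n" using real_arch_simple by blast
      then have "z t \<le> real n" if "t \<in> J" for t
        using member_le_sum[of t J "\<lambda>t. \<bar>z t\<bar>"] J that by fastforce
      with z show "z \<in> (\<Union>n. box (\<lambda>_. real n))" unfolding box_def by auto
    qed (auto simp: box_def)
  qed simp
qed

section \<open>Asymptotic tightness and marginals of a net\<close>

context function_net
begin

text \<open>A strict bound on an infimum is attained by some member, so enlargements become
  neighbourhoods by existence. This includes an empty K, whose enlargements are empty because the
  infimum is infinite.\<close>

lemma asymp_tight_iff:
  assumes L: "mspace L = M" "mdist L = d"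
  shows "asymp_tight F L P X \<longleftrightarrow> (\<forall>\<epsilon>>0. \<exists>K. compactin mtopology K \<and> nearly_in K \<epsilon>)"
proof -
  let ?p = "\<lambda>K \<delta> \<alpha>. inner_prob (P \<alpha>) {\<omega> \<in> space (P \<alpha>). X \<alpha> \<omega> \<in> enlargement L K \<delta>}"
  let ?q = "\<lambda>K \<delta> \<alpha>. inner_prob (P \<alpha>) {\<omega> \<in> space (P \<alpha>). \<exists>y\<in>K. d (X \<alpha> \<omega>) y < \<delta>}"
  have pq: "eventually (\<lambda>\<alpha>. ?p K \<delta> \<alpha> = ?q K \<delta> \<alpha>) F" for K \<delta>
    using eventually_I
  proof eventually_elim
    fix \<alpha> assume "\<alpha> \<in> I"
    then have "{\<omega> \<in> space (P \<alpha>). X \<alpha> \<omega> \<in> enlargement L K \<delta>} = {\<omega> \<in> space (P \<alpha>). \<exists>y\<in>K. d (X \<alpha> \<omega>) y < \<delta>}"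
      using X_mem L by (auto simp: enlargement_def INF_less_iff)
    then show "?p K \<delta> \<alpha> = ?q K \<delta> \<alpha>" by simp
  qed
  have "ereal (1 - \<epsilon>) \<le> Liminf F (\<lambda>\<alpha>. ereal (?p K \<delta> \<alpha>)) \<longleftrightarrow> (\<forall>e>0. eventually (\<lambda>\<alpha>. 1 - \<epsilon> - e < ?q K \<delta> \<alpha>) F)"
    for \<epsilon> K \<delta>
    unfolding le_Liminf_iff
  proof safe
    fix e :: real assume "0 < e" and *: "\<forall>y<ereal (1 - \<epsilon>). eventually (\<lambda>\<alpha>. y < ereal (?p K \<delta> \<alpha>)) F"
    have "eventually (\<lambda>\<alpha>. ereal (1 - \<epsilon> - e) < ereal (?p K \<delta> \<alpha>)) F"
      using \<open>0 < e\<close> by (intro *[rule_format]) simp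
    then show "eventually (\<lambda>\<alpha>. 1 - \<epsilon> - e < ?q K \<delta> \<alpha>) F"
      using pq[of K \<delta>] by eventually_elim simp
  next
    fix y assume *: "\<forall>e>0. eventually (\<lambda>\<alpha>. 1 - \<epsilon> - e < ?q K \<delta> \<alpha>) F" and y: "y < ereal (1 - \<epsilon>)"
    show "eventually (\<lambda>\<alpha>. y < ereal (?p K \<delta> \<alpha>)) F"
    proof (cases y)
      case (real r)
      \<comment> \<open>The slack is chosen so that the lower bound becomes r.\<close>
      have "eventually (\<lambda>\<alpha>. 1 - \<epsilon> - (1 - \<epsilon> - r) < ?q K \<delta> \<alpha>) F"
        using y real by (intro *[rule_format]) simp
      then show ?thesis using pq[of K \<delta>] by eventually_elim (simp add: real)
    qed (use y in auto)
  qed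
  moreover have "mtopology_of L = mtopology" using L by (simp add: mtopology_of_def)
  ultimately show ?thesis unfolding asymp_tight_def nearly_in_def by simp
qed

text \<open>Undoing the numbering t turns g into a continuous function on the Euclidean space.
  Outside J the inverse numbering is arbitrary, but g does not see those coordinates.\<close>

lemma fdd_of_marginal:
  assumes R: "net_weak_conv F (Euclidean_space k) P (\<lambda>\<alpha> \<omega>. marginal k t (X \<alpha> \<omega>)) R V"
    and t: "bij_betw t {..<k} J" and g: "coord_lipschitz J C g" and b: "\<And>z. \<bar>g z\<bar> \<le> b"
  shows "((\<lambda>\<alpha>. outer_expectation (P \<alpha>) (\<lambda>\<omega>. g (X \<alpha> \<omega>))) \<longlongrightarrow>
    ereal (\<integral>v. g (\<lambda>s. V v (inv_into {..<k} t s)) \<partial>R)) F"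
proof -
  let ?p = "inv_into {..<k} t" and ?h = "\<lambda>x. g (\<lambda>s. x (inv_into {..<k} t s))"
  have "continuous_map (Euclidean_space k) euclideanreal ?h"
    unfolding Euclidean_space_def
    by (intro continuous_map_from_subtopology continuous_map_coord_lipschitz[OF g])
  moreover have "bounded (?h ` topspace (Euclidean_space k))"
    using b by (auto simp: bounded_iff)
  ultimately have "((\<lambda>\<alpha>. outer_expectation (P \<alpha>) (\<lambda>\<omega>. ?h (marginal k t (X \<alpha> \<omega>)))) \<longlongrightarrow>
    ereal (\<integral>v. ?h (V v) \<partial>R)) F"
    using R unfolding net_weak_conv_def by blast
  moreover have "?h (marginal k t z) = g z" for z
  proof (rule coord_lipschitz_cong[OF g])
    fix s assume "s \<in> J"
    then have "?p s < k" "t (?p s) = s"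
      using t bij_betw_inv_into_right[OF t] inv_into_into[of s t "{..<k}"] by (auto simp: bij_betw_def)
    then show "marginal k t z (?p s) = z s" by (simp add: marginal_def)
  qed
  ultimately show ?thesis by simp
qed

lemma continuous_map_marginal:
  assumes "t ` {..<k} \<subseteq> T"
  shows "continuous_map mtopology (Euclidean_space k) (marginal k t)"
  unfolding Euclidean_space_def
proof (rule continuous_map_into_subtopology)
  show "continuous_map mtopology (powertop_real UNIV) (marginal k t)"
    unfolding continuous_map_componentwise_UNIV
  proof
    fix i
    show "continuous_map mtopology euclideanreal (\<lambda>x. marginal k t x i)"
    proof (cases "i < k")
      case True
      then have "t i \<in> T" using assms by auto
      with True show ?thesis
        using coord_le by (intro lipschitz_imp_continuous_map[of 1]) (auto simp: marginal_def)
    qed (simp add: marginal_def)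
  qed
qed (simp add: marginal_def)

lemma marginal_weak_conv:
  assumes Y: "net_weak_conv F mtopology P X Q Y" and t: "t ` {..<k} \<subseteq> T"
  shows "net_weak_conv F (Euclidean_space k) P (\<lambda>\<alpha> \<omega>. marginal k t (X \<alpha> \<omega>)) Q (\<lambda>v. marginal k t (Y v))"
  unfolding net_weak_conv_def
proof (intro conjI allI impI)
  note m = continuous_map_marginal[OF t]
  show "prob_space Q" using Y unfolding net_weak_conv_def by simp
  have "Y \<in> measurable Q (borel_of mtopology)" using Y unfolding net_weak_conv_def by simp
  then show "(\<lambda>v. marginal k t (Y v)) \<in> measurable Q (borel_of (Euclidean_space k))"
    using continuous_map_measurable_borel_of[OF m] by (rule measurable_compose)
  fix h assume h: "continuous_map (Euclidean_space k) euclideanreal h" "bounded (h ` topspace (Euclidean_space k))"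
  have "continuous_map mtopology euclideanreal (\<lambda>z. h (marginal k t z))"
    using continuous_map_compose[OF m h(1)] by (simp add: o_def)
  moreover have "bounded ((\<lambda>z. h (marginal k t z)) ` topspace mtopology)"
    using marginal_mem_Euclidean_space by (intro bounded_subset[OF h(2)]) auto
  ultimately show "((\<lambda>\<alpha>. outer_expectation (P \<alpha>) (\<lambda>\<omega>. h (marginal k t (X \<alpha> \<omega>)))) \<longlongrightarrow>
      ereal (\<integral>v. h (marginal k t (Y v)) \<partial>Q)) F"
    using Y unfolding net_weak_conv_def by blast
qed

text \<open>The open-set half of the portmanteau theorem for neighbourhoods of K. The bump max 0 (1
  - dist/\<delta>) is 1 on K and positive only within \<delta> of K; it is tested with a minus sign,
  because minus the outer expectation of -h bounds inner probabilities from below.\<close>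

lemma weak_conv_tight_imp_nearly_in:
  assumes Y: "net_weak_conv F mtopology P X Q Y" and tight: "tight_map mtopology Q Y" and \<epsilon>: "0 < \<epsilon>"
  shows "\<exists>K. compactin mtopology K \<and> nearly_in K \<epsilon>"
proof -
  interpret Q: prob_space Q using Y unfolding net_weak_conv_def by simp
  have Ym: "Y \<in> measurable Q (borel_of mtopology)" using Y unfolding net_weak_conv_def by simp
  obtain K where K: "compactin mtopology K" and QK: "1 - \<epsilon> \<le> measure Q {v \<in> space Q. Y v \<in> K}"
    using tight \<epsilon> unfolding tight_map_def by blast
  have "eventually (\<lambda>\<alpha>. 1 - \<epsilon> - e < inner_prob (P \<alpha>) {\<omega> \<in> space (P \<alpha>). \<exists>y\<in>K. d (X \<alpha> \<omega>) y < \<delta>}) F"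
    if \<delta>: "0 < \<delta>" and e: "0 < e" for \<delta> e
  proof (cases "K = {}")
    case True
    \<comment> \<open>For empty K the bound \<open>QK\<close> reads 1 - \<epsilon> \<le> 0, so
      nonnegativity of inner probability is enough.\<close>
    show ?thesis using eventually_I
    proof eventually_elim
      fix \<alpha> assume "\<alpha> \<in> I"
      then interpret prob_space "P \<alpha>" by (rule prob_P)
      have "0 \<le> inner_prob (P \<alpha>) {\<omega> \<in> space (P \<alpha>). \<exists>y\<in>K. d (X \<alpha> \<omega>) y < \<delta>}"
        using inner_prob_upper[of "{}"] by simp
      then show "1 - \<epsilon> - e < inner_prob (P \<alpha>) {\<omega> \<in> space (P \<alpha>). \<exists>y\<in>K. d (X \<alpha> \<omega>) y < \<delta>}"
        using QK True e by simp
    qed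
  next
    case False
    let ?\<rho> = "inf_conv K (\<lambda>_. 0) d"
    let ?h = "\<lambda>z. max 0 (1 - ?\<rho> z / \<delta>)"
    note KM = compactin_subset[OF K]
    have \<rho>0: "0 \<le> ?\<rho> z" for z using False by (intro inf_conv_ge) auto
    have h01: "0 \<le> ?h z" "?h z \<le> 1" for z using \<rho>0[of z] \<delta> by auto
    have hK: "?h z = 1" if "z \<in> K" for z
      using inf_conv_le[of K 0 "\<lambda>_. 0" d z z] \<rho>0[of z] that KM by (auto simp: subset_iff)
    have hpos: "\<exists>y\<in>K. d z y < \<delta>" if "0 < ?h z" for z
    proof (rule ccontr)
      assume "\<not> (\<exists>y\<in>K. d z y < \<delta>)"
      then have "\<delta> \<le> ?\<rho> z" using False by (intro inf_conv_ge) auto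
      with that \<delta> show False by (simp add: max_def field_simps split: if_splits)
    qed
    have cont: "continuous_map mtopology euclideanreal (\<lambda>z. - ?h z)"
    proof (rule lipschitz_imp_continuous_map)
      fix x y assume xy: "x \<in> M" "y \<in> M"
      have "d x w \<le> d x y + d y w" "d y w \<le> d x y + d x w" if "w \<in> K" for w
        using triangle[of x y w] triangle[of y x w] xy KM that by (auto simp: commute)
      then have "\<bar>?\<rho> x - ?\<rho> y\<bar> \<le> d x y" using False by (intro inf_conv_diff[where b = 0]) auto
      then have "\<bar>?\<rho> x / \<delta> - ?\<rho> y / \<delta>\<bar> \<le> d x y / \<delta>"
        using \<delta> by (simp add: diff_divide_distrib[symmetric] divide_right_mono)
      then have "\<bar>- ?h x - - ?h y\<bar> \<le> d x y / \<delta>" by linarith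
      then show "\<bar>- ?h x - - ?h y\<bar> \<le> 1 / \<delta> * d x y" by simp
    qed (use \<delta> in simp)
    have hb: "\<bar>- ?h z\<bar> \<le> 1" for z using h01[of z] by simp
    have "bounded ((\<lambda>z. - ?h z) ` topspace mtopology)"
      using hb by (auto intro!: boundedI[of _ 1] simp del: abs_minus_cancel)
    with cont have "((\<lambda>\<alpha>. outer_expectation (P \<alpha>) (\<lambda>\<omega>. - ?h (X \<alpha> \<omega>))) \<longlongrightarrow> ereal (\<integral>v. - ?h (Y v) \<partial>Q)) F"
      using Y unfolding net_weak_conv_def by blast
    then have lim: "((\<lambda>\<alpha>. oexp \<alpha> (\<lambda>z. - ?h z)) \<longlongrightarrow> (\<integral>v. - ?h (Y v) \<partial>Q)) F"
      using tendsto_oexp_iff[of "\<lambda>z. - ?h z" 1] hb by blast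
    have hY: "(\<lambda>v. - ?h (Y v)) \<in> borel_measurable Q"
      using measurable_compose[OF Ym continuous_map_borel_of[OF cont]] .
    have "closedin mtopology K" using Hausdorff_space_mtopology K by (rule compactin_imp_closedin)
    then have "topspace mtopology - K \<in> sets (borel_of mtopology)"
      unfolding sets_borel_of by (auto simp: closedin_def)
    from measurable_sets[OF Ym this] have "space Q - (Y -` (topspace mtopology - K) \<inter> space Q) \<in> Q.events"
      by blast
    also have "space Q - (Y -` (topspace mtopology - K) \<inter> space Q) = {v \<in> space Q. Y v \<in> K}"
      using measurable_space[OF Ym] by auto
    finally have B: "{v \<in> space Q. Y v \<in> K} \<in> Q.events" .
    have "(\<integral>v. - ?h (Y v) \<partial>Q) \<le> (\<integral>v. - indicator {v \<in> space Q. Y v \<in> K} v \<partial>Q)"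
    proof (rule integral_mono)
      show "integrable Q (\<lambda>v. - ?h (Y v))" using hY hb by (intro Q.bounded_integrable[of _ 1]) auto
      show "integrable Q (\<lambda>v. - indicator {v \<in> space Q. Y v \<in> K} v :: real)"
        using B by (auto intro!: integrable_real_indicator simp: Q.emeasure_eq_measure)
      show "- ?h (Y v) \<le> - indicator {v \<in> space Q. Y v \<in> K} v" for v
        using hK[of "Y v"] h01[of "Y v"] by (auto simp: indicator_def simp del: max.bounded_iff)
    qed
    also have "\<dots> = - measure Q {v \<in> space Q. Y v \<in> K}" using B by simp
    also have "\<dots> < - (1 - \<epsilon> - e)" using QK e by simp
    finally have "eventually (\<lambda>\<alpha>. oexp \<alpha> (\<lambda>z. - ?h z) < - (1 - \<epsilon> - e)) F"
      by (rule order_tendstoD(2)[OF lim])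
    then show ?thesis using eventually_I
    proof eventually_elim
      fix \<alpha> assume \<alpha>: "\<alpha> \<in> I" and less: "oexp \<alpha> (\<lambda>z. - ?h z) < - (1 - \<epsilon> - e)"
      interpret prob_space "P \<alpha>" using \<alpha> by (rule prob_P)
      have "- oexp \<alpha> (\<lambda>z. - ?h z) \<le> inner_prob (P \<alpha>) {\<omega> \<in> space (P \<alpha>). \<exists>y\<in>K. d (X \<alpha> \<omega>) y < \<delta>}"
        unfolding oexp_def using h01 hpos by (intro inner_prob_ge_outer_expectation) auto
      with less show "1 - \<epsilon> - e < inner_prob (P \<alpha>) {\<omega> \<in> space (P \<alpha>). \<exists>y\<in>K. d (X \<alpha> \<omega>) y < \<delta>}"
        by linarith
    qed
  qed
  with K show ?thesis unfolding nearly_in_def by blast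
qed

text \<open>Consistency of the limit laws comes from uniqueness of limits: a Lipschitz function of
  the coordinates J is also one of the coordinates H when J is a subset of H, so both laws give it
  the limit of the same net, and such integrals determine a law on the product over J.\<close>

lemma fdd_limit_exists:
  assumes R: "\<And>k t. inj_on t {..<k} \<Longrightarrow> t ` {..<k} \<subseteq> T \<Longrightarrow>
    \<exists>(R :: (nat \<Rightarrow> real) measure) V. net_weak_conv F (Euclidean_space k) P (\<lambda>\<alpha> \<omega>. marginal k t (X \<alpha> \<omega>)) R V"
  shows "\<exists>Q :: ('t \<Rightarrow> real) measure. fdd_limit M d T I F P X Q (\<lambda>t x. x t)"
proof -
  let ?lim = "\<lambda>g l. ((\<lambda>\<alpha>. outer_expectation (P \<alpha>) (\<lambda>\<omega>. g (X \<alpha> \<omega>))) \<longlongrightarrow> ereal l) F"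
  have "\<exists>A :: ('t \<Rightarrow> real) measure. prob_space A \<and> sets A = sets (PiM J (\<lambda>_. borel)) \<and>
      (\<forall>C g b. coord_lipschitz J C g \<longrightarrow> (\<forall>z. \<bar>g z\<bar> \<le> b) \<longrightarrow> ?lim g (\<integral>x. g x \<partial>A))"
    if J: "finite J" "J \<subseteq> T" for J
  proof -
    obtain t where t: "bij_betw t {..<card J} J"
      using ex_bij_betw_nat_finite[OF J(1)] by (auto simp: atLeast0LessThan)
    then have "inj_on t {..<card J}" "t ` {..<card J} \<subseteq> T" using J by (auto simp: bij_betw_def)
    then obtain R :: "(nat \<Rightarrow> real) measure" and V
      where RV: "net_weak_conv F (Euclidean_space (card J)) P (\<lambda>\<alpha> \<omega>. marginal (card J) t (X \<alpha> \<omega>)) R V"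
      using assms by blast
    then interpret R: prob_space R unfolding net_weak_conv_def by simp
    have V: "V \<in> measurable R (borel_of (Euclidean_space (card J)))" using RV unfolding net_weak_conv_def by simp
    have Vi: "(\<lambda>v. V v i) \<in> borel_measurable R" for i
    proof -
      have "continuous_map (Euclidean_space (card J)) euclideanreal (\<lambda>x. x i)"
        unfolding Euclidean_space_def
        by (intro continuous_map_from_subtopology continuous_map_product_projection) simp
      from measurable_compose[OF V continuous_map_borel_of[OF this]] show ?thesis .
    qed
    \<comment> \<open>The limit vector indexed by J itself, so that its law does not refer to the
      chosen numbering.\<close>
    let ?W = "\<lambda>v. \<lambda>s\<in>J. V v (inv_into {..<card J} t s)"
    have W: "?W \<in> measurable R (PiM J (\<lambda>_. borel))" using Vi by (intro measurable_restrict)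
    have "?lim g (\<integral>x. g x \<partial>distr R (PiM J (\<lambda>_. borel)) ?W)"
      if g: "coord_lipschitz J C g" and b: "\<forall>z. \<bar>g z\<bar> \<le> b" for C g b
    proof -
      have "(\<lambda>x. g (\<lambda>t. x t)) \<in> borel_measurable (PiM J (\<lambda>_. borel))"
        by (rule measurable_coord_lipschitz[OF g J(1)]) simp
      then have "(\<integral>x. g x \<partial>distr R (PiM J (\<lambda>_. borel)) ?W) = (\<integral>v. g (?W v) \<partial>R)"
        by (intro integral_distr[OF W]) simp
      also have "\<dots> = (\<integral>v. g (\<lambda>s. V v (inv_into {..<card J} t s)) \<partial>R)"
        by (intro Bochner_Integration.integral_cong refl coord_lipschitz_cong[OF g]) simp
      finally show ?thesis using fdd_of_marginal[OF RV t g, of b] b by simp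
    qed
    moreover have "prob_space (distr R (PiM J (\<lambda>_. borel)) ?W)" using W by (rule R.prob_space_distr)
    ultimately show ?thesis by (intro exI[of _ "distr R (PiM J (\<lambda>_. borel)) ?W"]) auto
  qed
  then have "\<forall>J. \<exists>A :: ('t \<Rightarrow> real) measure. finite J \<and> J \<subseteq> T \<longrightarrow> prob_space A \<and> sets A = sets (PiM J (\<lambda>_. borel)) \<and>
      (\<forall>C g b. coord_lipschitz J C g \<longrightarrow> (\<forall>z. \<bar>g z\<bar> \<le> b) \<longrightarrow> ?lim g (\<integral>x. g x \<partial>A))"
    by meson
  from choice[OF this] obtain A :: "'t set \<Rightarrow> ('t \<Rightarrow> real) measure" where
    A': "\<forall>J. finite J \<and> J \<subseteq> T \<longrightarrow> prob_space (A J) \<and> sets (A J) = sets (PiM J (\<lambda>_. borel)) \<and>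
      (\<forall>C g b. coord_lipschitz J C g \<longrightarrow> (\<forall>z. \<bar>g z\<bar> \<le> b) \<longrightarrow> ?lim g (\<integral>x. g x \<partial>A J))" by (rule exE)
  have A: "prob_space (A J)" "sets (A J) = sets (PiM J (\<lambda>_. borel))" if "finite J" "J \<subseteq> T" for J
    using A' that by auto
  have limA: "?lim g (\<integral>x. g x \<partial>A J)"
    if "finite J" "J \<subseteq> T" "coord_lipschitz J C g" "\<And>z. \<bar>g z\<bar> \<le> b" for J C g b
    using A' that by blast
  have consistent: "A J = distr (A H) (PiM J (\<lambda>_. borel)) (\<lambda>f. restrict f J)"
    if JH: "J \<subseteq> H" and H: "finite H" "H \<subseteq> T" for J H
  proof -
    have J: "finite J" "J \<subseteq> T" using JH H by (auto intro: finite_subset)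
    have res: "(\<lambda>f. restrict f J) \<in> measurable (A H) (PiM J (\<lambda>_. borel))"
      unfolding measurable_cong_sets[OF A(2)[OF H] refl] by (rule measurable_restrict_subset[OF JH])
    show ?thesis
    proof (rule measure_eqI_coord_lipschitz[OF A(1)[OF J] _ J(1) A(2)[OF J]])
      show "prob_space (distr (A H) (PiM J (\<lambda>_. borel)) (\<lambda>f. restrict f J))"
        using A(1)[OF H] res by (rule prob_space.prob_space_distr)
      fix C g assume g: "coord_lipschitz J C g" and b: "\<And>z. \<bar>g z\<bar> \<le> (1::real)"
      have "(\<lambda>x. g (\<lambda>t. x t)) \<in> borel_measurable (PiM J (\<lambda>_. borel))"
        by (rule measurable_coord_lipschitz[OF g J(1)]) simp
      then have "(\<integral>x. g x \<partial>distr (A H) (PiM J (\<lambda>_. borel)) (\<lambda>f. restrict f J)) = (\<integral>x. g (restrict x J) \<partial>A H)"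
        by (intro integral_distr[OF res]) simp
      also have "\<dots> = (\<integral>x. g x \<partial>A H)"
        by (intro Bochner_Integration.integral_cong refl coord_lipschitz_cong[OF g]) simp
      finally have H_eq: "(\<integral>x. g x \<partial>distr (A H) (PiM J (\<lambda>_. borel)) (\<lambda>f. restrict f J)) = (\<integral>x. g x \<partial>A H)" .
      have "ereal (\<integral>x. g x \<partial>A J) = ereal (\<integral>x. g x \<partial>A H)"
        using F_nontrivial limA[OF J g b] limA[OF H coord_lipschitz_mono[OF g JH H(1)] b]
        by (rule tendsto_unique)
      then show "(\<integral>x. g x \<partial>A J) = (\<integral>x. g x \<partial>distr (A H) (PiM J (\<lambda>_. borel)) (\<lambda>f. restrict f J))"
        using H_eq by simp
    qed simp
  qed
  \<comment> \<open>From here \<open>lim\<close> denotes the projective limit measure on the product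
    over T, as opposed to the convergence statement \<open>?lim\<close>.\<close>
  interpret polish_projective T A
    by (intro polish_projective.intro projective_family.intro) (fact consistent, fact A(1))
  have coord: "(\<lambda>x. x t) \<in> borel_measurable lim" if "t \<in> T" for t
    unfolding measurable_cong_sets[OF sets_lim refl] using that by (rule measurable_component_singleton)
  have lim: "?lim g (\<integral>x. g x \<partial>lim)"
    if J: "finite J" "J \<subseteq> T" and g: "coord_lipschitz J C g" and b: "\<And>z. \<bar>g z\<bar> \<le> b" for J C g b
  proof -
    have res: "(\<lambda>f. restrict f J) \<in> measurable lim (PiM J (\<lambda>_. borel))"
      unfolding measurable_cong_sets[OF sets_lim refl] by (rule measurable_restrict_subset[OF J(2)])
    have "distr lim (PiM J (\<lambda>_. borel)) (\<lambda>f. restrict f J) = A J"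
    proof (rule measure_eqI)
      show "sets (distr lim (PiM J (\<lambda>_. borel)) (\<lambda>f. restrict f J)) = sets (A J)" using A(2)[OF J] by simp
      fix B assume "B \<in> sets (distr lim (PiM J (\<lambda>_. borel)) (\<lambda>f. restrict f J))"
      then have B: "B \<in> sets (PiM J (\<lambda>_. borel))" by simp
      show "emeasure (distr lim (PiM J (\<lambda>_. borel)) (\<lambda>f. restrict f J)) B = emeasure (A J) B"
        using emeasure_lim_emb[OF J(2,1) B] emeasure_distr[OF res B]
        by (simp add: prod_emb_def space_PiM)
    qed
    then have "(\<integral>x. g x \<partial>A J) = (\<integral>x. g x \<partial>distr lim (PiM J (\<lambda>_. borel)) (\<lambda>f. restrict f J))" by simp
    also have "\<dots> = (\<integral>x. g (restrict x J) \<partial>lim)"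
    proof (rule integral_distr[OF res])
      have "(\<lambda>x. g (\<lambda>t. x t)) \<in> borel_measurable (PiM J (\<lambda>_. borel))"
        by (rule measurable_coord_lipschitz[OF g J(1)]) simp
      then show "g \<in> borel_measurable (PiM J (\<lambda>_. borel))" by simp
    qed
    also have "\<dots> = (\<integral>x. g x \<partial>lim)"
      by (intro Bochner_Integration.integral_cong refl coord_lipschitz_cong[OF g]) simp
    finally show ?thesis using limA[OF J g b] by simp
  qed
  have "fdd_limit M d T I F P X lim (\<lambda>t x. x t)"
    by (intro fdd_limit.intro fdd_limit_axioms.intro)
       (fact function_net_axioms, fact P.prob_space_axioms, fact coord, fact lim)
  then show ?thesis ..
qed

end

subsection \<open>The main theorem\<close>

lemma abs_diff_le_bi_dist:
  assumes zy: "z \<in> bdd_integrable N" "y \<in> bdd_integrable N" and t: "t \<in> space N"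
  shows "\<bar>z t - y t\<bar> \<le> bi_dist N z y"
proof -
  obtain b c where bc: "\<forall>t\<in>space N. \<bar>z t\<bar> \<le> b" "\<forall>t\<in>space N. \<bar>y t\<bar> \<le> c"
    using zy unfolding bdd_integrable_def bounded_iff by auto
  have "\<bar>z t - y t\<bar> \<le> max 0 (b + c)" if t: "t \<in> space N" for t
    using bspec[OF bc(1) t] bspec[OF bc(2) t] by linarith
  then have "bdd_above (insert 0 ((\<lambda>t. \<bar>z t - y t\<bar>) ` space N))"
    by (intro bdd_aboveI[of _ "max 0 (b + c)"]) auto
  then have "\<bar>z t - y t\<bar> \<le> Sup (insert 0 ((\<lambda>t. \<bar>z t - y t\<bar>) ` space N))"
    using t by (intro cSup_upper) auto
  then show ?thesis unfolding bi_dist_def bi_norm_def by simp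
qed

theorem theorem3p2:
  fixes T :: "'t set" and \<T> :: "'t set set" and \<mu> :: "'t set \<Rightarrow> ereal"
    and I :: "'i set" and le :: "'i \<Rightarrow> 'i \<Rightarrow> bool"
    and \<Omega> :: "'i \<Rightarrow> 'w measure" and X :: "'i \<Rightarrow> 'w \<Rightarrow> 't \<Rightarrow> real"
    and N :: "'t measure" and F :: "'i filter"
  assumes N: "N = total_variation T \<T> \<mu>"
    and F: "F = net_filter I le"
    and "signed_measure T \<T> \<mu>"
    and "sigma_finite_measure N"
    and "directed_set I le"
    and "\<And>\<alpha>. \<alpha> \<in> I \<Longrightarrow> prob_space (\<Omega> \<alpha>)"
    and "\<And>\<alpha>. \<alpha> \<in> I \<Longrightarrow> X \<alpha> \<in> space (\<Omega> \<alpha>) \<rightarrow> bdd_integrable N"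
  shows
    "((\<exists>(Q :: ('t \<Rightarrow> real) measure) Y.
          net_weak_conv F (bi_topology N) \<Omega> X Q Y \<and> tight_map (bi_topology N) Q Y)
      \<longleftrightarrow>
      asymp_tight F (bi_metric N) \<Omega> X \<and>
      (\<forall>k t. inj_on t {..<k} \<and> t ` {..<k} \<subseteq> T \<longrightarrow>
        (\<exists>(R :: (nat \<Rightarrow> real) measure) V.
          net_weak_conv F (Euclidean_space k) \<Omega> (\<lambda>\<alpha> \<omega>. marginal k t (X \<alpha> \<omega>)) R V)))
     \<and>
     (\<forall>(Q :: 'v measure) (Y :: 't \<Rightarrow> 'v \<Rightarrow> real).
        prob_space Q \<longrightarrow> (\<forall>t\<in>T. Y t \<in> borel_measurable Q) \<longrightarrow>
        asymp_tight F (bi_metric N) \<Omega> X \<longrightarrow>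
        (\<forall>k t. inj_on t {..<k} \<and> t ` {..<k} \<subseteq> T \<longrightarrow>
          net_weak_conv F (Euclidean_space k) \<Omega> (\<lambda>\<alpha> \<omega>. marginal k t (X \<alpha> \<omega>))
            Q (\<lambda>v. marginal k t (\<lambda>s. Y s v))) \<longrightarrow>
        (\<exists>Y' :: 'v \<Rightarrow> 't \<Rightarrow> real.
          (\<forall>v\<in>space Q. Y' v \<in> bdd_integrable N) \<and>
          (\<forall>t\<in>T. AE v in Q. Y' v t = Y t v) \<and>
          net_weak_conv F (bi_topology N) \<Omega> X Q Y'))"
proof -
  have space_N: "space N = T" unfolding N using assms(3) by (rule space_total_variation)
  have dir: "eventually Pr F \<longleftrightarrow> (\<exists>\<alpha>\<in>I. \<forall>\<beta>\<in>I. le \<alpha> \<beta> \<longrightarrow> Pr \<beta>)" for Pr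
    unfolding F using assms(5) by (rule eventually_net_filter)
  interpret net: function_net "bdd_integrable N" "bi_dist N" T I F \<Omega> X
  proof (intro function_net.intro function_metric.intro function_metric_axioms.intro function_net_axioms.intro)
    show "Metric_space (bdd_integrable N) (bi_dist N)" by (rule Metric_space_bdd_integrable)
    show "\<bar>z t - y t\<bar> \<le> bi_dist N z y" if "z \<in> bdd_integrable N" "y \<in> bdd_integrable N" "t \<in> T" for z y t
      using that by (intro abs_diff_le_bi_dist) (simp_all add: space_N)
    show "z = y" if "z \<in> bdd_integrable N" "y \<in> bdd_integrable N" "\<And>t. t \<in> T \<Longrightarrow> z t = y t" for z y
      using that unfolding bdd_integrable_def space_N by (auto intro: extensionalityI)
    \<comment> \<open>Every tail contains its own starting index, so the filter is nontrivial and
      limits along it are unique.\<close>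
    have "I \<noteq> {}" "\<forall>\<alpha>\<in>I. le \<alpha> \<alpha>" using assms(5) unfolding directed_set_def by blast+
    then show "eventually (\<lambda>\<alpha>. \<alpha> \<in> I) F" "F \<noteq> bot"
      unfolding trivial_limit_def dir by blast+
    show "prob_space (\<Omega> \<alpha>)" if "\<alpha> \<in> I" for \<alpha> using that by (rule assms(6))
    show "X \<alpha> \<omega> \<in> bdd_integrable N" if "\<alpha> \<in> I" "\<omega> \<in> space (\<Omega> \<alpha>)" for \<alpha> \<omega>
      using assms(7)[OF that(1)] that(2) by blast
  qed
  have top: "bi_topology N = net.mtopology" by (simp add: mtopology_of_def)
  have tight_iff: "asymp_tight F (bi_metric N) \<Omega> X \<longleftrightarrow> (\<forall>\<epsilon>>0. \<exists>K. compactin net.mtopology K \<and> net.nearly_in K \<epsilon>)"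
    by (rule net.asymp_tight_iff) simp_all
  have forward: "asymp_tight F (bi_metric N) \<Omega> X" (is ?A)
    "\<exists>(R :: (nat \<Rightarrow> real) measure) V. net_weak_conv F (Euclidean_space k) \<Omega> (\<lambda>\<alpha> \<omega>. marginal k t (X \<alpha> \<omega>)) R V" (is ?B)
    if Y: "net_weak_conv F net.mtopology \<Omega> X Q Y" "tight_map net.mtopology Q Y" and t: "t ` {..<k} \<subseteq> T"
    for Q :: "('t \<Rightarrow> real) measure" and Y k t
  proof -
    show ?A unfolding tight_iff using net.weak_conv_tight_imp_nearly_in[OF Y] by blast
    \<comment> \<open>The marginal limit is first defined on the space of Q; passing to its law
      yields a limit on sequences, the type that the statement asks for.\<close>
    show ?B using net_weak_conv_law[OF net.marginal_weak_conv[OF Y(1) t]] by blast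
  qed
  have backward: "\<exists>(Q :: ('t \<Rightarrow> real) measure) Y. net_weak_conv F net.mtopology \<Omega> X Q Y \<and> tight_map net.mtopology Q Y"
    if A: "asymp_tight F (bi_metric N) \<Omega> X"
      and R: "\<And>k t. inj_on t {..<k} \<Longrightarrow> t ` {..<k} \<subseteq> T \<Longrightarrow> \<exists>(R :: (nat \<Rightarrow> real) measure) V.
        net_weak_conv F (Euclidean_space k) \<Omega> (\<lambda>\<alpha> \<omega>. marginal k t (X \<alpha> \<omega>)) R V"
  proof -
    obtain Q :: "('t \<Rightarrow> real) measure"
      where "fdd_limit (bdd_integrable N) (bi_dist N) T I F \<Omega> X Q (\<lambda>t x. x t)"
      using net.fdd_limit_exists[OF R] by blast
    \<comment> \<open>The process is the canonical one, the coordinates under the projective limit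
      law.\<close>
    then interpret fdd_limit "bdd_integrable N" "bi_dist N" T I F \<Omega> X Q "\<lambda>t x. x t" .
    obtain Y' where "net_weak_conv F net.mtopology \<Omega> X Q Y'" "tight_map net.mtopology Q Y'"
      by (rule version_weak_limit) (use A tight_iff in blast)+
    then show ?thesis by blast
  qed
  have moreover_part: "\<exists>Y' :: 'v \<Rightarrow> 't \<Rightarrow> real. (\<forall>v\<in>space Q. Y' v \<in> bdd_integrable N) \<and>
      (\<forall>t\<in>T. AE v in Q. Y' v t = Y t v) \<and> net_weak_conv F net.mtopology \<Omega> X Q Y'"
    if Q: "prob_space Q" and Y: "\<forall>t\<in>T. Y t \<in> borel_measurable Q"
      and A: "asymp_tight F (bi_metric N) \<Omega> X"
      and R: "\<And>k t. inj_on t {..<k} \<Longrightarrow> t ` {..<k} \<subseteq> T \<Longrightarrow>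
        net_weak_conv F (Euclidean_space k) \<Omega> (\<lambda>\<alpha> \<omega>. marginal k t (X \<alpha> \<omega>)) Q (\<lambda>v. marginal k t (\<lambda>s. Y s v))"
    for Q :: "'v measure" and Y
  proof -
    interpret Q: prob_space Q by fact
    interpret fdd_limit "bdd_integrable N" "bi_dist N" T I F \<Omega> X Q Y
    proof
      show "Y t \<in> borel_measurable Q" if "t \<in> T" for t using Y that by blast
      fix J C b and g :: "('t \<Rightarrow> real) \<Rightarrow> real"
      assume J: "finite J" "J \<subseteq> T" and g: "coord_lipschitz J C g" and b: "\<And>z. \<bar>g z\<bar> \<le> b"
      obtain t where t: "bij_betw t {..<card J} J"
        using ex_bij_betw_nat_finite[OF J(1)] by (auto simp: atLeast0LessThan)
      then have t': "inj_on t {..<card J}" "t ` {..<card J} \<subseteq> T" using J by (auto simp: bij_betw_def)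
      \<comment> \<open>Numbering J and undoing the numbering restores all coordinates that g sees,
        so the limit is expressed through Y itself.\<close>
      have eq: "g (\<lambda>s. marginal (card J) t (\<lambda>s. Y s v) (inv_into {..<card J} t s)) = g (\<lambda>s. Y s v)" for v
      proof (rule coord_lipschitz_cong[OF g])
        fix s assume "s \<in> J"
        then have "inv_into {..<card J} t s < card J" "t (inv_into {..<card J} t s) = s"
          using t bij_betw_inv_into_right[OF t] inv_into_into[of s t "{..<card J}"] by (auto simp: bij_betw_def)
        then show "marginal (card J) t (\<lambda>s. Y s v) (inv_into {..<card J} t s) = Y s v"
          by (simp add: marginal_def)
      qed
      show "((\<lambda>\<alpha>. outer_expectation (\<Omega> \<alpha>) (\<lambda>\<omega>. g (X \<alpha> \<omega>))) \<longlongrightarrow> ereal (\<integral>v. g (\<lambda>t. Y t v) \<partial>Q)) F"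
        using net.fdd_of_marginal[OF R[OF t'] t g b] by (simp only: eq)
    qed
    obtain Y' where "\<And>v. v \<in> space Q \<Longrightarrow> Y' v \<in> bdd_integrable N" "\<And>t. t \<in> T \<Longrightarrow> AE v in Q. Y' v t = Y t v"
      "net_weak_conv F net.mtopology \<Omega> X Q Y'"
      by (rule version_weak_limit) (use A tight_iff in blast)+
    then show ?thesis by blast
  qed
  show ?thesis
    unfolding top
  proof (intro conjI iffI)
    assume "\<exists>(Q :: ('t \<Rightarrow> real) measure) Y. net_weak_conv F net.mtopology \<Omega> X Q Y \<and> tight_map net.mtopology Q Y"
    then obtain Q :: "('t \<Rightarrow> real) measure" and Y
      where Y: "net_weak_conv F net.mtopology \<Omega> X Q Y" "tight_map net.mtopology Q Y" by blast
    \<comment> \<open>Tightness involves no coordinates; k = 0 makes the premise on t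
      vacuous.\<close>
    show "asymp_tight F (bi_metric N) \<Omega> X" using forward(1)[OF Y, of _ 0] by simp
    show "\<forall>k t. inj_on t {..<k} \<and> t ` {..<k} \<subseteq> T \<longrightarrow> (\<exists>(R :: (nat \<Rightarrow> real) measure) V.
        net_weak_conv F (Euclidean_space k) \<Omega> (\<lambda>\<alpha> \<omega>. marginal k t (X \<alpha> \<omega>)) R V)"
      using forward(2)[OF Y] by simp
  next
    assume "asymp_tight F (bi_metric N) \<Omega> X \<and>
      (\<forall>k t. inj_on t {..<k} \<and> t ` {..<k} \<subseteq> T \<longrightarrow> (\<exists>(R :: (nat \<Rightarrow> real) measure) V.
        net_weak_conv F (Euclidean_space k) \<Omega> (\<lambda>\<alpha> \<omega>. marginal k t (X \<alpha> \<omega>)) R V))"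
    then show "\<exists>(Q :: ('t \<Rightarrow> real) measure) Y. net_weak_conv F net.mtopology \<Omega> X Q Y \<and> tight_map net.mtopology Q Y"
      by (intro backward) simp_all
  qed (simp add: moreover_part)
qed

end
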